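(* Let $\mathcal M$ be a multiset with $b_i\ge 1$ copies of $i$ for $1\le i\le T$, and let $b=b_1+\dots+b_T$. Let $(x_0,x_1,\dots,x_b)$ be a probability distribution on $\{0,\dots,b\}$ with $x_b>0$, let $0<\alpha_i<1$ for $1\le i\le b-b_T$, and put $z_k=\sum_{i=0}^k x_i$. Then the (unique) stationary probability distribution of the Infinite Multispecies Reverse Juggling Markov Chain (IMRJMC) is given by $$\pi(\tau,\mathbf n)=\frac1Z\,\alpha^{\mathbf c}(\tau)\prod_{k=1}^{b} z_{k-1}^{\,n_k-n_{k-1}-1},$$ where $n_0=0$ and $Z$ is the partition function (the normalizing constant).
   Context: $S(\mathcal M)$ is the set of multipermutations $\tau=(\tau_1,\dots,\tau_b)$ of $\mathcal M$. A state of the IMRJMC is a pair $(\tau,\mathbf n)$ with $\tau\in S(\mathcal M)$ and $\mathbf n=(n_1,\dots,n_b)$ a tuple of integers with $1\le n_1<\dots<n_b$; it represents a ball labelled $\tau_j$ at position $n_j$ for each $j$. Code and weight: $c_i=c_i(\tau)=\#\{k: i<k,\ \tau_i>\tau_k\}$ and $\alpha^{\mathbf c}(\tau)=\prod_{i=1}^b \alpha_1\alpha_2\cdots\alpha_{c_i}$ (an empty product is $1$). Convention: $0^0=1$. Transitions of the IMRJMC from $(\tau,\mathbf n)$: (1) with probability $x_0$, $\tau$ is unchanged and $\mathbf n\to(n_1+1,\dots,n_b+1)$; (2) for each $1\le j\le b$, with probability $x_j$, $\mathbf n\to(1,n_1+1,\dots,n_{j-1}+1,n_{j+1}+1,\dots,n_b+1)$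 and $\tau$ is changed by a random bumping path from index $j$, which is the following procedure. Suppose there are $\ell$ balls with labels smaller than $\tau_j$ to the left of index $j$ in $\tau$, at indices $i_1<\dots<i_\ell<j$, and $r$ balls with labels smaller than $\tau_j$ to the right of index $j$. The ball $\tau_j$ bumps the ball at index $i_k$ ($1\le k\le \ell$), i.e. takes its place, with probability $(1-\alpha_{r+\ell-k+1})\prod_{s=1}^{\ell-k}\alpha_{r+s}$, or moves to the front ("index zero") without bumping any ball, with probability $\prod_{s=1}^{\ell}\alpha_{r+s}$. If the ball at index $i_k$ is bumped, the same step is repeated with $j$ replaced by $i_k$, i.e. for the ball labelled $\tau_{i_k}$ starting from index $i_k$ (with the corresponding $\ell$, $r$ for that ball), and so on, until some ball is placed at index zero. Finally, if the path started at index $j$, all balls at indices $0,\dots,j-1$ are moved one index to the right, giving a new element of $S(\mathcal M)$. *)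

theory Defs
  imports "HOL-Probability.Probability" "HOL-Combinatorics.Multiset_Permutations"
begin

text \<open>
  Indices are 1-based. A list is preceded by an extra entry \<open>0\<close> at index zero: for a tuple of
  positions this is the convention $n_0 = 0$, for a multipermutation it is the free place in front
  of all balls.
\<close>

definition entry :: "nat list \<Rightarrow> nat \<Rightarrow> nat" where
  "entry xs i = (0 # xs) ! i"

definition imrjmc_states :: "nat multiset \<Rightarrow> (nat list \<times> nat list) set" where
  "imrjmc_states M =
     {(\<tau>, ns). \<tau> \<in> permutations_of_multiset M \<and> length ns = size M \<and>
                sorted_wrt (<) ns \<and> (\<forall>n\<in>set ns. 1 \<le> n)}"

definition code :: "nat list \<Rightarrow> nat \<Rightarrow> nat" where
  "code \<tau> i = card {k \<in> {1..length \<tau>}. i < k \<and> entry \<tau> i > entry \<tau> k}"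

definition code_weight :: "(nat \<Rightarrow> real) \<Rightarrow> nat list \<Rightarrow> real" where
  "code_weight \<alpha> \<tau> = (\<Prod>i=1..length \<tau>. \<Prod>s=1..code \<tau> i. \<alpha> s)"

text \<open>
  The choice made by a ball with \<open>l\<close> smaller balls to its left and \<open>r\<close> smaller balls to its right:
  the value \<open>k \<ge> 1\<close> stands for bumping the \<open>k\<close>-th of the \<open>l\<close> balls, the value \<open>0\<close> for moving to
  the front.
\<close>

definition bump_prob :: "(nat \<Rightarrow> real) \<Rightarrow> nat \<Rightarrow> nat \<Rightarrow> nat \<Rightarrow> real" where
  "bump_prob \<alpha> l r k =
     (if k = 0 then \<Prod>s=1..l. \<alpha> (r + s)
      else if k \<le> l then (1 - \<alpha> (r + l - k + 1)) * (\<Prod>s=1..l - k. \<alpha> (r + s))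
      else 0)"

definition bump_choice :: "(nat \<Rightarrow> real) \<Rightarrow> nat \<Rightarrow> nat \<Rightarrow> nat pmf" where
  "bump_choice \<alpha> l r = embed_pmf (bump_prob \<alpha> l r)"

lemma sum_bump_prob: "(\<Sum>k\<le>l. bump_prob \<alpha> l r k) = 1"
proof -
  define P where "P m = (\<Prod>s=1..m. \<alpha> (r + s))" for m
  have "(\<Sum>k\<le>l. bump_prob \<alpha> l r k) = P l + (\<Sum>k=1..l. bump_prob \<alpha> l r k)"
    by (simp add: sum.atMost_shift sum.atLeast1_atMost_eq bump_prob_def P_def)
  also have "(\<Sum>k=1..l. bump_prob \<alpha> l r k) = (\<Sum>k=1..l. P (l - k) - P (Suc (l - k)))"
    by (intro sum.cong) (auto simp: bump_prob_def P_def algebra_simps)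
  also have "\<dots> = (\<Sum>m<l. P m - P (Suc m))"
    by (rule sum.reindex_bij_witness[of _ "\<lambda>m. l - m" "\<lambda>k. l - k"]) auto
  also have "\<dots> = P 0 - P l"
    by (rule sum_lessThan_telescope')
  finally show ?thesis
    by (simp add: P_def)
qed

lemma pmf_bump_choice:
  assumes "\<And>s. 1 \<le> s \<Longrightarrow> s \<le> l \<Longrightarrow> 0 \<le> \<alpha> (r + s) \<and> \<alpha> (r + s) \<le> 1"
  shows "pmf (bump_choice \<alpha> l r) k = bump_prob \<alpha> l r k"
  unfolding bump_choice_def
proof (rule pmf_embed_pmf)
  show nonneg: "0 \<le> bump_prob \<alpha> l r k" for k
  proof (cases "1 \<le> k \<and> k \<le> l")
    case True
    then have "\<alpha> (r + (l - k + 1)) \<le> 1"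
      using assms[of "l - k + 1"] by auto
    moreover have "r + l - k + 1 = r + (l - k + 1)"
      using True by simp
    ultimately show ?thesis
      using True assms by (auto simp: bump_prob_def intro!: mult_nonneg_nonneg prod_nonneg)
  qed (auto simp: bump_prob_def assms intro!: prod_nonneg)
  have "(\<integral>\<^sup>+ k. ennreal (bump_prob \<alpha> l r k) \<partial>count_space UNIV) =
        (\<Sum>k\<le>l. ennreal (bump_prob \<alpha> l r k))"
    by (rule nn_integral_count_space') (auto simp: bump_prob_def)
  also have "\<dots> = 1"
    using nonneg by (simp add: sum_ennreal sum_bump_prob)
  finally show "(\<integral>\<^sup>+ k. ennreal (bump_prob \<alpha> l r k) \<partial>count_space UNIV) = 1" .
qed

text \<open>
  The smaller balls on the left are listed as $i_1 < \dots < i_\ell$. The numbers of smaller balls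
  may be taken from the original arrangement \<open>\<tau>\<close> along the whole path, because the balls that have
  been moved so far are larger than the current one.
\<close>

definition smaller_left :: "nat list \<Rightarrow> nat \<Rightarrow> nat list" where
  "smaller_left \<tau> j = filter (\<lambda>i. entry \<tau> i < entry \<tau> j) [1..<j]"

definition smaller_right :: "nat list \<Rightarrow> nat \<Rightarrow> nat" where
  "smaller_right \<tau> j = card {i \<in> {1..length \<tau>}. j < i \<and> entry \<tau> i < entry \<tau> j}"

text \<open>
  The list \<open>w\<close> is the current arrangement on the indices $0, \dots, b$. The guard \<open>i < j\<close> holds
  for every \<open>i\<close> chosen with positive probability when the parameters are in the unit interval, as
  then \<open>k \<le> l\<close> by \<open>pmf_bump_choice\<close>; it serves termination only.
\<close>

function bump_path :: "(nat \<Rightarrow> real) \<Rightarrow> nat list \<Rightarrow> nat \<Rightarrow> nat list \<Rightarrow> nat list pmf" where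
  "bump_path \<alpha> \<tau> j w =
     bind_pmf (bump_choice \<alpha> (length (smaller_left \<tau> j)) (smaller_right \<tau> j)) (\<lambda>k.
       let i = entry (smaller_left \<tau> j) k; w' = w[i := entry \<tau> j]
       in if 0 < i \<and> i < j then bump_path \<alpha> \<tau> i w' else return_pmf w')"
  by auto
termination
  by (relation "Wellfounded.measure (\<lambda>(\<alpha>, \<tau>, j, w). j)") auto

declare bump_path.simps [simp del]

text \<open>
  At the end of a path from \<open>j\<close> the place \<open>j\<close> is vacant; deleting it from the arrangement on
  $0, \dots, b$ moves the balls at $0, \dots, j-1$ one index to the right.
\<close>

definition bump :: "(nat \<Rightarrow> real) \<Rightarrow> nat list \<Rightarrow> nat \<Rightarrow> nat list pmf" where
  "bump \<alpha> \<tau> j = map_pmf (\<lambda>w. take j w @ drop (Suc j) w) (bump_path \<alpha> \<tau> j (0 # \<tau>))"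

definition imrjmc_step ::
  "nat pmf \<Rightarrow> (nat \<Rightarrow> real) \<Rightarrow> nat list \<times> nat list \<Rightarrow> (nat list \<times> nat list) pmf" where
  "imrjmc_step x \<alpha> = (\<lambda>(\<tau>, ns).
     bind_pmf x (\<lambda>j.
       if j = 0 then return_pmf (\<tau>, map Suc ns)
       else map_pmf (\<lambda>\<tau>'. (\<tau>', 1 # map Suc (take (j - 1) ns @ drop j ns))) (bump \<alpha> \<tau> j)))"

definition stationary_distribution :: "'s set \<Rightarrow> ('s \<Rightarrow> 's pmf) \<Rightarrow> 's pmf \<Rightarrow> bool" where
  "stationary_distribution S K p \<longleftrightarrow> set_pmf p \<subseteq> S \<and> bind_pmf p K = p"

definition imrjmc_weight :: "nat pmf \<Rightarrow> (nat \<Rightarrow> real) \<Rightarrow> nat list \<times> nat list \<Rightarrow> real" where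
  "imrjmc_weight x \<alpha> = (\<lambda>(\<tau>, ns).
     code_weight \<alpha> \<tau> *
     (\<Prod>k=1..length ns. (\<Sum>i\<le>k - 1. pmf x i) ^ (entry ns k - entry ns (k - 1) - 1)))"

definition partition_function :: "nat multiset \<Rightarrow> nat pmf \<Rightarrow> (nat \<Rightarrow> real) \<Rightarrow> real" where
  "partition_function M x \<alpha> = (\<Sum>\<^sub>\<infinity>s\<in>imrjmc_states M. imrjmc_weight x \<alpha> s)"

end

theory Submission
  imports Defs
begin

text \<open>
  A random bumping path from index $j$, followed by the shift, is the composition of random adjacent
  steps that carry one ball from index $j$ to the front: when the carried ball $a$ has a ball $c$
  directly on its left, $c\,a$ becomes $a\,c$, except that for $c < a$ with $R$ balls smaller than
  $a$ on the right this happens only with probability $\alpha_{R+1}$, and otherwise $c$ is carried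
  from there on. Since $a\,c$ then has $\alpha_{R+1}$ times the weight of $c\,a$, every
  adjacent step preserves $\alpha^{\mathbf c}$, and so does bumping from any fixed $j$. Hence the two
  components of the state decouple. The gaps between the balls are independent and geometric: drawing
  $j$ from $x$ by successive trials with hazard rates $x_k / (1 - z_{k-1})$ reduces stationarity of
  the positions to one identity between neighbouring geometric distributions. For uniqueness,
  throwing the last ball repeatedly can act as bubble sort, so that all states reach the sorted
  arrangement at positions $1, \dots, b$.
\<close>

section \<open>Bumping paths as sequences of adjacent steps\<close>

lemma bump_choice_0: "bump_choice \<alpha> 0 r = return_pmf 0"
  by (rule pmf_eqI) (simp add: pmf_bump_choice bump_prob_def)

text \<open>The ball inspects the smaller balls on its left from right to left. The nearest one is
  bumped with probability 1 - \<alpha>_{r+1}; if it is passed, it becomes one of the smaller balls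
  on the right, which turns \<open>r\<close> into \<open>Suc r\<close>.\<close>

lemma bump_choice_Suc:
  assumes "\<And>s. 0 \<le> \<alpha> s \<and> \<alpha> s \<le> 1"
  shows "bump_choice \<alpha> (Suc l) r =
    bind_pmf (bernoulli_pmf (\<alpha> (Suc r)))
      (\<lambda>h. if h then bump_choice \<alpha> l (Suc r) else return_pmf (Suc l))"
proof (rule pmf_eqI)
  fix k
  have shift: "(\<Prod>s=Suc 0..Suc n. \<alpha> (r + s)) = \<alpha> (Suc r) * (\<Prod>s=Suc 0..n. \<alpha> (Suc r + s))" for n
    by (induction n) simp_all
  have "bump_prob \<alpha> (Suc l) r k =
    \<alpha> (Suc r) * bump_prob \<alpha> l (Suc r) k + (1 - \<alpha> (Suc r)) * (if k = Suc l then 1 else 0)"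
  proof (cases "k = 0 \<or> k > l")
    case True
    then show ?thesis
      by (auto simp: bump_prob_def shift simp del: prod.cl_ivl_Suc)
  next
    case False
    then show ?thesis
      by (auto simp: bump_prob_def shift Suc_diff_le simp del: prod.cl_ivl_Suc)
  qed
  then show "pmf (bump_choice \<alpha> (Suc l) r) k =
    pmf (bind_pmf (bernoulli_pmf (\<alpha> (Suc r)))
      (\<lambda>h. if h then bump_choice \<alpha> l (Suc r) else return_pmf (Suc l))) k"
    using assms by (simp add: pmf_bind pmf_bump_choice indicator_def)
qed

lemma set_bump_choice:
  assumes "\<And>s. 0 \<le> \<alpha> s \<and> \<alpha> s \<le> 1" and "k \<in> set_pmf (bump_choice \<alpha> l r)"
  shows "k \<le> l"
  using assms by (auto simp: set_pmf_iff pmf_bump_choice bump_prob_def split: if_splits)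

definition num_less :: "nat list \<Rightarrow> nat \<Rightarrow> nat" where
  "num_less xs a = length (filter (\<lambda>c. c < a) xs)"

lemma num_less_simps [simp]:
  "num_less [] a = 0"
  "num_less (c # xs) a = (if c < a then Suc (num_less xs a) else num_less xs a)"
  "num_less (xs @ ys) a = num_less xs a + num_less ys a"
  by (simp_all add: num_less_def)

lemma num_less_mset: "mset xs = mset ys \<Longrightarrow> num_less xs a = num_less ys a"
  unfolding num_less_def by (metis mset_filter size_mset)

text \<open>Places are counted from 0 here, and the carried ball sits at place \<open>Suc m\<close>.
  After the step it is the ball at place \<open>m\<close> that is carried: \<open>a\<close> if it
  passed \<open>c\<close>, and \<open>c\<close> if it was bumped, in which case the list itself does
  not change.\<close>

definition adjacent_step :: "(nat \<Rightarrow> real) \<Rightarrow> nat \<Rightarrow> nat list \<Rightarrow> nat list pmf" where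
  "adjacent_step \<alpha> m \<tau> =
     (let c = \<tau> ! m; a = \<tau> ! Suc m; \<tau>' = \<tau>[m := a, Suc m := c]
      in if c < a
         then map_pmf (\<lambda>h. if h then \<tau>' else \<tau>)
                (bernoulli_pmf (\<alpha> (Suc (num_less (drop (Suc (Suc m)) \<tau>) a))))
         else return_pmf \<tau>')"

primrec slide :: "(nat \<Rightarrow> real) \<Rightarrow> nat \<Rightarrow> nat list \<Rightarrow> nat list pmf" where
  "slide \<alpha> 0 \<tau> = return_pmf \<tau>"
| "slide \<alpha> (Suc m) \<tau> = bind_pmf (adjacent_step \<alpha> m \<tau>) (slide \<alpha> m)"

lemma adjacent_step_append:
  assumes "length u = m"
  shows "adjacent_step \<alpha> m (u @ c # a # v) =
    (if c < a
     then map_pmf (\<lambda>h. if h then u @ a # c # v else u @ c # a # v)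
            (bernoulli_pmf (\<alpha> (Suc (num_less v a))))
     else return_pmf (u @ a # c # v))"
  using assms by (auto simp: adjacent_step_def nth_append list_update_append Let_def)

text \<open>Unrolls a single choice among all smaller balls on the left into adjacent steps. The
  function \<open>f\<close> is the continuation after the choice: \<open>f 0\<close> is arrival at
  the front, and \<open>f i\<close> carries the ball bumped at index \<open>i\<close> onwards, with
  \<open>a\<close> left directly behind it.\<close>

lemma slide_eq_bind_bump_choice:
  assumes unit: "\<And>s. 0 \<le> \<alpha> s \<and> \<alpha> s \<le> 1" and "m \<le> length \<tau>"
    and "f 0 = return_pmf (a # take m \<tau> @ v)"
    and "\<And>i. 1 \<le> i \<Longrightarrow> i \<le> m \<Longrightarrow> entry \<tau> i < a \<Longrightarrow>
           f i = slide \<alpha> (i - 1) (take i \<tau> @ a # drop i (take m \<tau>) @ v)"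
  shows "bind_pmf
      (bump_choice \<alpha> (length (filter (\<lambda>i. entry \<tau> i < a) [1..<Suc m])) (num_less v a))
      (\<lambda>k. f (entry (filter (\<lambda>i. entry \<tau> i < a) [1..<Suc m]) k))
    = slide \<alpha> m (take m \<tau> @ a # v)"
  using assms(2-)
proof (induction m arbitrary: v)
  case 0
  then show ?case
    by (simp add: bump_choice_0 bind_return_pmf entry_def)
next
  case (Suc m)
  let ?L = "filter (\<lambda>i. entry \<tau> i < a) [1..<Suc m]"
  define c where "c = \<tau> ! m"
  have take: "take (Suc m) \<tau> = take m \<tau> @ [c]"
    using Suc.prems(1) by (simp add: c_def take_Suc_conv_app_nth)
  have c: "entry \<tau> (Suc m) = c"
    by (simp add: entry_def c_def)
  \<comment> \<open>Once \<open>a\<close> has passed \<open>c\<close>, the ball \<open>c\<close>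
    belongs to the part behind. The count of smaller balls there grows exactly when
    \<open>c < a\<close>, as in \<open>bump_choice_Suc\<close>.\<close>
  have IH: "bind_pmf (bump_choice \<alpha> (length ?L) (num_less (c # v) a)) (\<lambda>k. f (entry ?L k)) =
      slide \<alpha> m (take m \<tau> @ a # c # v)"
  proof (rule Suc.IH)
    show "f 0 = return_pmf (a # take m \<tau> @ c # v)"
      using Suc.prems(2) by (simp add: take)
    fix i assume i: "1 \<le> i" "i \<le> m" "entry \<tau> i < a"
    then show "f i = slide \<alpha> (i - 1) (take i \<tau> @ a # drop i (take m \<tau>) @ c # v)"
      using Suc.prems(1) Suc.prems(3)[of i] by (simp add: take)
  qed (use Suc.prems(1) in simp)
  have len: "length (take m \<tau>) = m"
    using Suc.prems(1) by simp
  show ?case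
  proof (cases "c < a")
    case True
    have L: "filter (\<lambda>i. entry \<tau> i < a) [1..<Suc (Suc m)] = ?L @ [Suc m]"
      using True by (simp add: c)
    have "bind_pmf (bump_choice \<alpha> (length ?L) (Suc (num_less v a)))
        (\<lambda>k. f (entry (?L @ [Suc m]) k)) =
      bind_pmf (bump_choice \<alpha> (length ?L) (Suc (num_less v a))) (\<lambda>k. f (entry ?L k))"
    proof (intro bind_pmf_cong refl arg_cong[where f = f])
      fix k assume "k \<in> set_pmf (bump_choice \<alpha> (length ?L) (Suc (num_less v a)))"
      then have "k \<le> length ?L"
        using unit set_bump_choice by blast
      then show "entry (?L @ [Suc m]) k = entry ?L k"
        unfolding entry_def by (cases k) (auto simp del: upt_Suc simp: nth_append)
    qed
    also have "\<dots> = slide \<alpha> m (take m \<tau> @ a # c # v)"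
      using IH True by simp
    finally have stay: "bind_pmf (bump_choice \<alpha> (length ?L) (Suc (num_less v a)))
        (\<lambda>k. f (entry (?L @ [Suc m]) k)) = slide \<alpha> m (take m \<tau> @ a # c # v)" .
    \<comment> \<open>The largest value of the choice selects the nearest candidate,
      \<open>c\<close> itself, which is then carried while \<open>a\<close> stays behind it.\<close>
    have go: "f (entry (?L @ [Suc m]) (Suc (length ?L))) = slide \<alpha> m (take m \<tau> @ c # a # v)"
      using Suc.prems(3)[of "Suc m"] Suc.prems(1) True
      by (simp add: entry_def c c_def take)
    show ?thesis
      unfolding L take
      using True stay go
      by (auto simp: bump_choice_Suc[OF unit] adjacent_step_append[OF len] bind_map_pmf
          bind_assoc_pmf bind_return_pmf simp del: upt_Suc intro!: bind_pmf_cong)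
  next
    case False
    have L: "filter (\<lambda>i. entry \<tau> i < a) [1..<Suc (Suc m)] = ?L"
      using False by (simp add: c)
    show ?thesis
      unfolding L take
      using False IH
      by (simp add: adjacent_step_append[OF len] bind_return_pmf del: upt_Suc)
  qed
qed

lemma smaller_right_eq: "smaller_right \<tau> j = num_less (drop j \<tau>) (entry \<tau> j)"
proof -
  have "num_less (drop j \<tau>) (entry \<tau> j) =
      card {i. i < length \<tau> - j \<and> \<tau> ! (j + i) < entry \<tau> j}"
    unfolding num_less_def length_filter_conv_card
    by (intro arg_cong[where f = card]) auto
  also have "\<dots> = smaller_right \<tau> j"
    unfolding smaller_right_def
  proof (rule bij_betw_same_card[of "\<lambda>i. Suc (j + i)"], rule bij_betwI[of _ _ _ "\<lambda>i. i - j - 1"])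
  qed (auto simp: entry_def)
  finally show ?thesis by simp
qed

text \<open>Invariant of a path that started at \<open>j\<close> and has reached \<open>i\<close>.
  The arrangement \<open>w\<close> is untouched to the left of \<open>i\<close>, and removing place
  \<open>j\<close> gives the arrangement of which \<open>slide\<close> sees the part behind
  \<open>i\<close>. The last hypothesis allows the counts read off the original
  \<open>\<tau>\<close>; it passes to a bumped index \<open>i'\<close> because \<open>a\<close>
  occurs behind \<open>i'\<close> in both lists.\<close>

lemma map_bump_path:
  assumes unit: "\<And>s. 0 \<le> \<alpha> s \<and> \<alpha> s \<le> 1"
    and "1 \<le> i" "i \<le> j" "j \<le> length \<tau>" "length w = Suc (length \<tau>)"
    and "take i w = take i (0 # \<tau>)"
    and "\<And>c. c \<le> entry \<tau> i \<Longrightarrow>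
           num_less (drop i (take j w @ drop (Suc j) w)) c = num_less (drop i \<tau>) c"
  shows "map_pmf (\<lambda>w. take j w @ drop (Suc j) w) (bump_path \<alpha> \<tau> i w) =
    slide \<alpha> (i - 1) (take i \<tau> @ drop i (take j w @ drop (Suc j) w))"
  using assms(2-)
proof (induction i arbitrary: w rule: less_induct)
  case (less i)
  define del where "del w = take j w @ drop (Suc j) w" for w :: "nat list"
  define a where "a = entry \<tau> i"
  define v where "v = drop i (del w)"
  define f where "f i' = (if 0 < i' \<and> i' < i
    then map_pmf del (bump_path \<alpha> \<tau> i' (w[i' := a])) else return_pmf (del (w[i' := a])))" for i'
  obtain m where m: "i = Suc m"
    using less.prems(1) by (cases i) auto
  have "take i (del w) = take i w"
    using less.prems by (simp add: del_def)
  \<comment> \<open>The leading 0 is the place still free at the front. In the sliding picture the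
    carried ball \<open>a\<close> stands between \<open>take m \<tau>\<close> and \<open>v\<close>
    instead.\<close>
  then have delw: "del w = (0 # take m \<tau>) @ v"
    using less.prems(5) append_take_drop_id[of i "del w"] by (simp add: v_def m)
  have del_update: "del (w[i' := a]) = ((0 # take m \<tau>) @ v)[i' := a]" if "i' < i" for i'
  proof -
    have "del (w[i' := a]) = (del w)[i' := a]"
      using that less.prems by (auto simp: del_def take_update_swap list_update_append)
    then show ?thesis by (simp add: delw)
  qed
  have take_i: "take i \<tau> = take m \<tau> @ [a]"
    using less.prems by (simp add: m a_def entry_def take_Suc_conv_app_nth)
  have count: "num_less v c = num_less (drop i \<tau>) c" if "c \<le> a" for c
    using less.prems(6) that by (simp add: v_def del_def a_def)
  have r: "smaller_right \<tau> i = num_less v a"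
    by (simp add: smaller_right_eq count a_def)
  have "map_pmf del (bump_path \<alpha> \<tau> i w) =
    bind_pmf (bump_choice \<alpha> (length (smaller_left \<tau> i)) (smaller_right \<tau> i))
      (\<lambda>k. f (entry (smaller_left \<tau> i) k))"
    by (subst bump_path.simps)
      (auto simp: map_bind_pmf Let_def f_def a_def intro!: bind_pmf_cong)
  also have "\<dots> = slide \<alpha> m (take m \<tau> @ a # v)"
    unfolding r smaller_left_def unfolding a_def[symmetric] unfolding m
  proof (rule slide_eq_bind_bump_choice[OF unit])
    show "m \<le> length \<tau>"
      using less.prems m by simp
    show "f 0 = return_pmf (a # take m \<tau> @ v)"
      using del_update[of 0] by (simp add: f_def m)
    fix i' assume i': "1 \<le> i'" "i' \<le> m" "entry \<tau> i' < a"
    have len: "length (take m \<tau>) = m"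
      using less.prems m by simp
    have drop: "drop i' (del (w[i' := a])) = a # drop i' (take m \<tau>) @ v"
    proof -
      obtain n where n: "i' = Suc n" using i' by (cases i') auto
      have "n < length (take m \<tau>)" using n i' len by simp
      then have "(take m \<tau> @ v)[n := a] = take n (take m \<tau>) @ a # drop (Suc n) (take m \<tau>) @ v"
        by (simp add: list_update_append upd_conv_take_nth_drop)
      moreover have "length (take n (take m \<tau>)) = n" using \<open>n < _\<close> by simp
      ultimately show ?thesis
        using del_update[of i'] i' by (simp add: m n)
    qed
    have drop_tau: "drop i' \<tau> = drop i' (take m \<tau>) @ a # drop i \<tau>"
    proof -
      have "\<tau> = take m \<tau> @ a # drop i \<tau>"
        using append_take_drop_id[of i \<tau>] by (simp add: take_i)
      then have "drop i' \<tau> = drop i' (take m \<tau> @ a # drop i \<tau>)" by simp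
      then show ?thesis using i' len by (simp del: append_take_drop_id)
    qed
    have "map_pmf (\<lambda>w. take j w @ drop (Suc j) w) (bump_path \<alpha> \<tau> i' (w[i' := a])) =
      slide \<alpha> (i' - 1)
        (take i' \<tau> @ drop i' (take j (w[i' := a]) @ drop (Suc j) (w[i' := a])))"
    proof (rule less.IH)
      show "take i' (w[i' := a]) = take i' (0 # \<tau>)"
        using less.prems(5) i' m by (metis (no_types) le_SucI min.absorb1 take_take take_update_cancel order_refl)
      fix c assume "c \<le> entry \<tau> i'"
      then show "num_less (drop i' (take j (w[i' := a]) @ drop (Suc j) (w[i' := a]))) c =
          num_less (drop i' \<tau>) c"
        using drop i' count[of c] by (simp add: del_def drop_tau)
    qed (use i' m less.prems in auto)
    then show "f i' = slide \<alpha> (i' - 1) (take i' \<tau> @ a # drop i' (take m \<tau>) @ v)"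
      using i' m drop by (simp add: f_def del_def[abs_def])
  qed
  finally show ?case
    unfolding del_def[abs_def] using take_i by (simp add: m v_def del_def)
qed

lemma bump_eq_slide:
  assumes "\<And>s. 0 \<le> \<alpha> s \<and> \<alpha> s \<le> 1" and "1 \<le> j" "j \<le> length \<tau>"
  shows "bump \<alpha> \<tau> j = slide \<alpha> (j - 1) \<tau>"
proof -
  have "drop j (take j (0 # \<tau>) @ drop (Suc j) (0 # \<tau>)) = drop j \<tau>"
    using assms by simp
  then show ?thesis
    using map_bump_path[of \<alpha> j j \<tau> "0 # \<tau>"] assms by (simp add: bump_def)
qed

section \<open>Stationarity of the code weight\<close>

lemma code_Cons_Suc:
  assumes "1 \<le> i"
  shows "code (a # xs) (Suc i) = code xs i"
  unfolding code_def
  by (rule bij_betw_same_card[of "\<lambda>k. k - 1"], rule bij_betwI[of _ _ _ Suc])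
    (use assms in \<open>auto simp: entry_def nth_Cons'\<close>)

lemma code_Cons_1: "code (a # xs) (Suc 0) = num_less xs a"
proof -
  have "num_less xs a = card {i. i < length xs \<and> xs ! i < a}"
    unfolding num_less_def length_filter_conv_card by simp
  also have "\<dots> = code (a # xs) (Suc 0)"
    unfolding code_def
    by (rule bij_betw_same_card[of "\<lambda>k. k + 2"], rule bij_betwI[of _ _ _ "\<lambda>k. k - 2"])
      (auto simp: entry_def nth_Cons' Suc_diff_Suc numeral_2_eq_2)
  finally show ?thesis ..
qed

lemma code_weight_Nil [simp]: "code_weight \<alpha> [] = 1"
  by (simp add: code_weight_def)

lemma code_weight_Cons:
  "code_weight \<alpha> (a # xs) = (\<Prod>s=1..num_less xs a. \<alpha> s) * code_weight \<alpha> xs"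
proof -
  have "code_weight \<alpha> (a # xs) = (\<Prod>i<Suc (length xs). \<Prod>s=1..code (a # xs) (Suc i). \<alpha> s)"
    by (simp add: code_weight_def prod.atLeast1_atMost_eq)
  also have "\<dots> = (\<Prod>s=1..num_less xs a. \<alpha> s) *
      (\<Prod>i<length xs. \<Prod>s=1..code xs (Suc i). \<alpha> s)"
    by (simp add: prod.lessThan_Suc_shift code_Cons_1 code_Cons_Suc del: prod.lessThan_Suc)
  finally show ?thesis
    by (simp add: code_weight_def prod.atLeast1_atMost_eq)
qed

lemma code_weight_pos:
  assumes "\<And>s. 0 < \<alpha> s"
  shows "0 < code_weight \<alpha> xs"
  by (induction xs) (auto simp: code_weight_Cons assms intro!: mult_pos_pos prod_pos)

text \<open>Each ball of \<open>u\<close> contributes a factor that depends only on the multiset of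
  balls behind it, so rearranging the suffix leaves these factors alone.\<close>

lemma code_weight_append:
  assumes "mset v = mset v'" and "code_weight \<alpha> v' = k * code_weight \<alpha> v"
  shows "code_weight \<alpha> (u @ v') = k * code_weight \<alpha> (u @ v)"
proof (induction u)
  case (Cons a u)
  moreover have "num_less (u @ v') a = num_less (u @ v) a"
    using assms(1) by (intro num_less_mset) simp
  ultimately show ?case by (simp add: code_weight_Cons)
qed (simp add: assms)

text \<open>Only the code of \<open>a\<close> changes: it gains the ball \<open>c\<close>. The
  larger ball \<open>a\<close> is never counted by \<open>c\<close>.\<close>

lemma code_weight_swap:
  assumes "c < a"
  shows "code_weight \<alpha> (u @ a # c # v) =
    \<alpha> (Suc (num_less v a)) * code_weight \<alpha> (u @ c # a # v)"
  by (rule code_weight_append) (use assms in \<open>auto simp: code_weight_Cons\<close>)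

section \<open>The normalized code weight and its invariance\<close>

definition multiperm_pmf :: "(nat \<Rightarrow> real) \<Rightarrow> nat multiset \<Rightarrow> nat list pmf" where
  "multiperm_pmf \<alpha> M = embed_pmf (\<lambda>\<tau>. if \<tau> \<in> permutations_of_multiset M
     then code_weight \<alpha> \<tau> / (\<Sum>\<sigma>\<in>permutations_of_multiset M. code_weight \<alpha> \<sigma>) else 0)"

lemma sum_code_weight_pos:
  assumes "\<And>s. 0 < \<alpha> s"
  shows "0 < (\<Sum>\<sigma>\<in>permutations_of_multiset M. code_weight \<alpha> \<sigma>)"
  using assms by (intro sum_pos) (auto simp: code_weight_pos)

lemma pmf_multiperm:
  assumes "\<And>s. 0 < \<alpha> s"
  shows "pmf (multiperm_pmf \<alpha> M) \<tau> = (if \<tau> \<in> permutations_of_multiset M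
     then code_weight \<alpha> \<tau> / (\<Sum>\<sigma>\<in>permutations_of_multiset M. code_weight \<alpha> \<sigma>) else 0)"
  unfolding multiperm_pmf_def
proof (rule pmf_embed_pmf)
  let ?P = "permutations_of_multiset M"
  let ?Z = "\<Sum>\<sigma>\<in>?P. code_weight \<alpha> \<sigma>"
  have Z: "0 < ?Z" using assms by (rule sum_code_weight_pos)
  have w: "0 \<le> code_weight \<alpha> \<tau>" for \<tau>
    using code_weight_pos[of \<alpha> \<tau>] assms by (simp add: less_imp_le)
  show "0 \<le> (if \<tau> \<in> ?P then code_weight \<alpha> \<tau> / ?Z else 0)" for \<tau>
    using Z w by simp
  have "(\<integral>\<^sup>+\<tau>. ennreal (if \<tau> \<in> ?P then code_weight \<alpha> \<tau> / ?Z else 0) \<partial>count_space UNIV) =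
      (\<Sum>\<tau>\<in>?P. ennreal (if \<tau> \<in> ?P then code_weight \<alpha> \<tau> / ?Z else 0))"
    by (rule nn_integral_count_space') auto
  also have "\<dots> = (\<Sum>\<tau>\<in>?P. ennreal (code_weight \<alpha> \<tau> / ?Z))"
    by (intro sum.cong) auto
  also have "\<dots> = ennreal (\<Sum>\<tau>\<in>?P. code_weight \<alpha> \<tau> / ?Z)"
    using Z w by (intro sum_ennreal) simp
  also have "(\<Sum>\<tau>\<in>?P. code_weight \<alpha> \<tau> / ?Z) = 1"
    using Z by (simp flip: sum_divide_distrib)
  finally show "(\<integral>\<^sup>+\<tau>. ennreal (if \<tau> \<in> ?P then code_weight \<alpha> \<tau> / ?Z else 0) \<partial>count_space UNIV) = 1"
    by simp
qed

lemma set_multiperm_pmf: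
  assumes "\<And>s. 0 < \<alpha> s"
  shows "set_pmf (multiperm_pmf \<alpha> M) \<subseteq> permutations_of_multiset M"
  using assms by (auto simp: set_pmf_iff pmf_multiperm split: if_splits)

lemma split_at_two:
  assumes "Suc m < length \<tau>"
  obtains u c a v where "\<tau> = u @ c # a # v" "length u = m"
proof
  show "\<tau> = take m \<tau> @ \<tau> ! m # \<tau> ! Suc m # drop (Suc (Suc m)) \<tau>"
    using assms by (metis Cons_nth_drop_Suc Suc_lessD append_take_drop_id)
qed (use assms in simp)

lemma bind_multiperm_adjacent_step:
  assumes \<alpha>: "\<And>s. 0 < \<alpha> s \<and> \<alpha> s < 1" and m: "Suc m < size M"
  shows "bind_pmf (multiperm_pmf \<alpha> M) (adjacent_step \<alpha> m) = multiperm_pmf \<alpha> M"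
proof (rule pmf_eqI)
  fix \<sigma>
  let ?P = "permutations_of_multiset M"
  let ?p = "multiperm_pmf \<alpha> M"
  have pos: "\<And>s. 0 < \<alpha> s" using \<alpha> by blast
  have len: "length \<tau> = size M" if "\<tau> \<in> ?P" for \<tau>
    using that by (metis permutations_of_multisetD size_mset)
  have sum: "pmf (bind_pmf ?p (adjacent_step \<alpha> m)) \<sigma> =
      (\<Sum>\<tau>\<in>?P. pmf (adjacent_step \<alpha> m \<tau>) \<sigma> * pmf ?p \<tau>)"
    unfolding pmf_bind using set_multiperm_pmf[of \<alpha> M, OF pos]
    by (intro integral_measure_pmf_real) auto
  \<comment> \<open>An adjacent step either fixes the list or exchanges two neighbours, so the only
    possible sources of \<open>\<sigma>\<close> are \<open>\<sigma>\<close> and its exchange at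
    \<open>m\<close>.\<close>
  have src: "mset \<tau> = mset \<sigma> \<and> (\<exists>u c a v. length u = m \<and> \<sigma> = u @ c # a # v \<and>
      (\<tau> = u @ c # a # v \<or> \<tau> = u @ a # c # v))"
    if "\<tau> \<in> ?P" "pmf (adjacent_step \<alpha> m \<tau>) \<sigma> \<noteq> 0" for \<tau>
  proof -
    have "Suc m < length \<tau>"
      using m len[OF that(1)] by simp
    then obtain u c a v where \<tau>: "\<tau> = u @ c # a # v" "length u = m"
      by (rule split_at_two)
    have "\<sigma> \<in> set_pmf (adjacent_step \<alpha> m \<tau>)"
      using that(2) by (simp add: set_pmf_iff)
    then have "\<sigma> = \<tau> \<or> \<sigma> = u @ a # c # v"
      using \<tau> by (auto simp: adjacent_step_append split: if_splits)
    then show ?thesis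
      using \<tau> by fastforce
  qed
  show "pmf (bind_pmf ?p (adjacent_step \<alpha> m)) \<sigma> = pmf ?p \<sigma>"
  proof (cases "\<sigma> \<in> ?P")
    case False
    then have "pmf (adjacent_step \<alpha> m \<tau>) \<sigma> = 0" if "\<tau> \<in> ?P" for \<tau>
      using src[OF that] that by (auto simp: permutations_of_multiset_def)
    then show ?thesis
      using False by (simp add: sum pmf_multiperm[OF pos])
  next
    case True
    have "Suc m < length \<sigma>"
      using m len[OF True] by simp
    then obtain u c a v where \<sigma>: "\<sigma> = u @ c # a # v" "length u = m"
      by (rule split_at_two)
    define \<sigma>' where "\<sigma>' = u @ a # c # v"
    have \<sigma>': "\<sigma>' \<in> ?P"
      using True by (simp add: \<sigma>'_def permutations_of_multiset_def \<sigma> add_mset_commute)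
    have "(\<Sum>\<tau>\<in>?P. pmf (adjacent_step \<alpha> m \<tau>) \<sigma> * pmf ?p \<tau>) =
        (\<Sum>\<tau>\<in>{\<sigma>, \<sigma>'}. pmf (adjacent_step \<alpha> m \<tau>) \<sigma> * pmf ?p \<tau>)"
    proof (intro sum.mono_neutral_right ballI)
      fix \<tau> assume \<tau>: "\<tau> \<in> ?P - {\<sigma>, \<sigma>'}"
      have "pmf (adjacent_step \<alpha> m \<tau>) \<sigma> = 0"
      proof (rule ccontr)
        assume "pmf (adjacent_step \<alpha> m \<tau>) \<sigma> \<noteq> 0"
        then obtain u' c' a' v' where "length u' = m" "\<sigma> = u' @ c' # a' # v'"
            "\<tau> = u' @ c' # a' # v' \<or> \<tau> = u' @ a' # c' # v'"
          using src[of \<tau>] \<tau> by blast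
        then show False
          using \<tau> \<sigma> by (auto simp: \<sigma>'_def)
      qed
      then show "pmf (adjacent_step \<alpha> m \<tau>) \<sigma> * pmf ?p \<tau> = 0"
        by simp
    qed (use True \<sigma>' in auto)
    also have "\<dots> = pmf ?p \<sigma>"
    proof -
      let ?Z = "\<Sum>\<sigma>\<in>?P. code_weight \<alpha> \<sigma>"
      have p: "pmf ?p \<tau> = code_weight \<alpha> \<tau> / ?Z" if "\<tau> \<in> {\<sigma>, \<sigma>'}" for \<tau>
        using that True \<sigma>' by (auto simp: pmf_multiperm[OF pos])
      have Z: "?Z \<noteq> 0"
        using sum_code_weight_pos[of \<alpha> M, OF pos] by simp
      have bern: "pmf (map_pmf (\<lambda>h. if h then s else t) (bernoulli_pmf (\<alpha> k))) y =
          (if y = s then \<alpha> k else 0) + (if y = t then 1 - \<alpha> k else 0)" for s t y :: "nat list" and k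
        using \<alpha>[of k] by (simp add: map_pmf_def pmf_bind less_imp_le)
      \<comment> \<open>For \<open>c < a\<close>, \<open>\<sigma>\<close> stays with probability 1 -
        \<alpha>_k and receives all of \<open>\<sigma>'\<close>, whose weight is \<alpha>_k times
        its own. For \<open>a < c\<close>, \<open>\<sigma>\<close> is left surely and receives the
        fraction \<alpha>_k of \<open>\<sigma>'\<close>, which is exactly its weight. For equal
        labels the two lists coincide.\<close>
      consider "c < a" | "a < c" | "a = c" by linarith
      then show ?thesis
      proof cases
        case 1
        then show ?thesis
          using code_weight_swap[OF 1, of \<alpha> u v] \<sigma>(2) Z
          by (simp add: p) (simp add: \<sigma> \<sigma>'_def adjacent_step_append bern field_simps)
      next
        case 2
        then show ?thesis
          using code_weight_swap[OF 2, of \<alpha> u v] \<sigma>(2) Z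
          by (simp add: p) (simp add: \<sigma> \<sigma>'_def adjacent_step_append bern field_simps)
      next
        case 3
        then show ?thesis
          using \<sigma>(2) by (simp add: \<sigma> \<sigma>'_def adjacent_step_append)
      qed
    qed
    finally show ?thesis by (simp add: sum)
  qed
qed

lemma bind_multiperm_slide:
  assumes "\<And>s. 0 < \<alpha> s \<and> \<alpha> s < 1" and "m < size M"
  shows "bind_pmf (multiperm_pmf \<alpha> M) (slide \<alpha> m) = multiperm_pmf \<alpha> M"
  using assms(2)
proof (induction m)
  case (Suc m)
  have "bind_pmf (multiperm_pmf \<alpha> M) (slide \<alpha> (Suc m)) =
    bind_pmf (bind_pmf (multiperm_pmf \<alpha> M) (adjacent_step \<alpha> m)) (slide \<alpha> m)"
    by (simp add: bind_assoc_pmf slide.simps(2)[abs_def])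
  also have "\<dots> = multiperm_pmf \<alpha> M"
    using Suc assms(1) by (simp add: bind_multiperm_adjacent_step)
  finally show ?case .
qed (simp add: bind_return_pmf' slide.simps(1)[abs_def])

lemma bind_multiperm_bump:
  assumes "\<And>s. 0 < \<alpha> s \<and> \<alpha> s < 1" and "1 \<le> j" "j \<le> size M"
  shows "bind_pmf (multiperm_pmf \<alpha> M) (\<lambda>\<tau>. bump \<alpha> \<tau> j) = multiperm_pmf \<alpha> M"
proof -
  have "bind_pmf (multiperm_pmf \<alpha> M) (\<lambda>\<tau>. bump \<alpha> \<tau> j) =
      bind_pmf (multiperm_pmf \<alpha> M) (slide \<alpha> (j - 1))"
  proof (intro bind_pmf_cong refl bump_eq_slide)
    fix \<tau> assume "\<tau> \<in> set_pmf (multiperm_pmf \<alpha> M)"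
    then have "\<tau> \<in> permutations_of_multiset M"
      using assms(1) set_multiperm_pmf[of \<alpha> M] by blast
    then show "j \<le> length \<tau>"
      using assms(3) by (metis permutations_of_multisetD size_mset)
  qed (use assms in \<open>auto intro: less_imp_le\<close>)
  then show ?thesis
    using assms by (simp add: bind_multiperm_slide)
qed

section \<open>Stationarity of the positions\<close>

text \<open>Deleting a ball merges its gap with the next one and adds the place it occupied, which
  is the \<open>Suc\<close>. The convolution of two geometric laws is a difference of powers divided
  by \<open>t - t'\<close>, and the mixing probability cancels that denominator.\<close>

lemma geometric_convolution:
  assumes "0 < t'" "t' \<le> t" "t \<le> 1"
  shows "bind_pmf (bernoulli_pmf ((t - t') / t)) (\<lambda>h. if h
      then bind_pmf (geometric_pmf t) (\<lambda>d. map_pmf (\<lambda>e. Suc (d + e)) (geometric_pmf t'))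
      else geometric_pmf t) = geometric_pmf t'"
proof (rule pmf_eqI)
  fix n
  have t: "0 < t" using assms by linarith
  have y: "0 \<le> (t - t') / t" "(t - t') / t \<le> 1"
    using assms t by (auto simp: field_simps)
  have "pmf (bind_pmf (geometric_pmf t) (\<lambda>d. map_pmf (\<lambda>e. Suc (d + e)) (geometric_pmf t'))) n =
      (\<Sum>d<n. pmf (map_pmf (\<lambda>e. Suc (d + e)) (geometric_pmf t')) n * pmf (geometric_pmf t) d)"
    unfolding pmf_bind
    by (rule integral_measure_pmf_real) (auto simp: pmf_eq_0_set_pmf)
  also have "\<dots> = (\<Sum>d<n. (1 - t') ^ (n - Suc d) * t' * ((1 - t) ^ d * t))"
  proof (intro sum.cong refl)
    fix d assume d: "d \<in> {..<n}"
    have "pmf (map_pmf (\<lambda>e. Suc (d + e)) (geometric_pmf t')) (Suc (d + (n - Suc d))) =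
        pmf (geometric_pmf t') (n - Suc d)"
      by (rule pmf_map_inj') (auto simp: inj_on_def)
    then show "pmf (map_pmf (\<lambda>e. Suc (d + e)) (geometric_pmf t')) n * pmf (geometric_pmf t) d =
        (1 - t') ^ (n - Suc d) * t' * ((1 - t) ^ d * t)"
      using d assms t by simp
  qed
  also have "\<dots> = t * t' * (\<Sum>d<n. (1 - t') ^ (n - Suc d) * (1 - t) ^ d)"
    by (simp add: sum_distrib_left algebra_simps)
  finally have conv: "pmf (bind_pmf (geometric_pmf t)
      (\<lambda>d. map_pmf (\<lambda>e. Suc (d + e)) (geometric_pmf t'))) n =
      t * t' * (\<Sum>d<n. (1 - t') ^ (n - Suc d) * (1 - t) ^ d)" .
  \<comment> \<open>Kept in multiplied form so that the case \<open>t = t'\<close> is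
    included.\<close>
  have "(t - t') * (\<Sum>d<n. (1 - t') ^ (n - Suc d) * (1 - t) ^ d) = (1 - t') ^ n - (1 - t) ^ n"
    using power_diff_sumr2[of "1 - t" n "1 - t'"] by (simp add: algebra_simps)
  then have "(t - t') / t * (t * t' * (\<Sum>d<n. (1 - t') ^ (n - Suc d) * (1 - t) ^ d)) =
      t' * ((1 - t') ^ n - (1 - t) ^ n)"
    using t by (simp add: mult_ac)
  moreover have "(1 - (t - t') / t) * ((1 - t) ^ n * t) = t' * (1 - t) ^ n"
    using t by (simp add: field_simps)
  ultimately show "pmf (bind_pmf (bernoulli_pmf ((t - t') / t)) (\<lambda>h. if h
      then bind_pmf (geometric_pmf t) (\<lambda>d. map_pmf (\<lambda>e. Suc (d + e)) (geometric_pmf t'))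
      else geometric_pmf t)) n = pmf (geometric_pmf t') n"
    using assms t y by (simp add: pmf_bind[of "bernoulli_pmf _"] conv algebra_simps)
qed

section \<open>Drawing an index from \<open>x\<close> by successive trials\<close>

definition tail :: "nat pmf \<Rightarrow> nat \<Rightarrow> real" where
  "tail x k = measure_pmf.prob x {k..}"

lemma tail_0 [simp]: "tail x 0 = 1"
  by (simp add: tail_def atLeast_0)

lemma tail_le_1: "tail x k \<le> 1"
  by (simp add: tail_def)

lemma tail_rec: "tail x k = pmf x k + tail x (Suc k)"
proof -
  have "{k..} = insert k {Suc k..}" by auto
  then show ?thesis
    unfolding tail_def
    by (simp add: measure_pmf.finite_measure_Union[of "{k}" x "{Suc k..}", simplified]
        measure_pmf_single)
qed

lemma tail_pos: "0 < pmf x b \<Longrightarrow> k \<le> b \<Longrightarrow> 0 < tail x k"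
  unfolding tail_def
  by (erule order.strict_trans2, subst measure_pmf_single[symmetric])
    (auto intro!: measure_pmf.finite_measure_mono)

text \<open>Connects the tails with the numbers z_k of the weight: a geometric gap with success
  probability \<open>tail x k\<close>, k \<ge> 1, has failure probability z_{k-1}.\<close>

lemma one_minus_tail: "1 - tail x (Suc k) = (\<Sum>i\<le>k. pmf x i)"
proof (induction k)
  case 0
  then show ?case using tail_rec[of x 0] by simp
next
  case (Suc k)
  then show ?case using tail_rec[of x "Suc k"] by simp
qed

text \<open>With \<open>k + m = b\<close> this is the law \<open>x\<close> conditioned on indices at
  least \<open>k\<close>. Each index is accepted with its hazard rate, and the last index
  \<open>b\<close> is taken if all earlier trials fail.\<close>

primrec hazard_pmf :: "nat pmf \<Rightarrow> nat \<Rightarrow> nat \<Rightarrow> nat pmf" where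
  "hazard_pmf x k 0 = return_pmf k"
| "hazard_pmf x k (Suc m) = bind_pmf (bernoulli_pmf (pmf x k / tail x k))
     (\<lambda>h. if h then return_pmf k else hazard_pmf x (Suc k) m)"

lemma pmf_hazard:
  assumes "set_pmf x \<subseteq> {0..b}" "0 < pmf x b" "k + m = b"
  shows "pmf (hazard_pmf x k m) j = (if k \<le> j then pmf x j / tail x k else 0)"
  using assms(3)
proof (induction m arbitrary: k)
  case 0
  have x: "pmf x i = 0" if "b < i" for i
    using assms(1) that by (auto simp: set_pmf_iff)
  have "tail x (Suc b) = 0"
    using assms(1) by (auto simp: tail_def measure_pmf_zero_iff)
  then have "tail x b = pmf x b"
    using tail_rec[of x b] by simp
  then show ?case
    using 0 x assms(2) by (auto simp: indicator_def)
next
  case (Suc m)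
  have t: "0 < tail x k" "0 < tail x (Suc k)"
    using Suc.prems assms(2) by (auto intro: tail_pos)
  have r: "tail x k = pmf x k + tail x (Suc k)" by (rule tail_rec)
  have y: "0 \<le> pmf x k / tail x k" "pmf x k / tail x k \<le> 1"
    using t r by (auto simp: field_simps)
  have "1 - pmf x k / tail x k = tail x (Suc k) / tail x k"
    using t r by (simp add: field_simps)
  moreover have "pmf (hazard_pmf x (Suc k) m) j = (if Suc k \<le> j then pmf x j / tail x (Suc k) else 0)"
    by (rule Suc.IH) (use Suc.prems in simp)
  ultimately show ?case
    using y t by (cases "j = k") (auto simp: pmf_bind indicator_def)
qed

lemma hazard_pmf_eq:
  assumes "set_pmf x \<subseteq> {0..b}" "0 < pmf x b"
  shows "hazard_pmf x 0 b = x"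
  by (rule pmf_eqI) (simp add: pmf_hazard[OF assms])

lemma set_hazard_pmf: "j \<in> set_pmf (hazard_pmf x k m) \<Longrightarrow> k \<le> j"
  by (induction m arbitrary: k) (auto split: if_splits dest: Suc_leD)

text \<open>The law of \<open>m\<close> further positions beyond \<open>p\<close>. The variable
  \<open>d\<close> is the number of empty places before the next ball, which is geometric with
  parameter \<open>tail x k\<close>, so a ball directly behind \<open>p\<close> corresponds to
  \<open>d = 0\<close>.\<close>

primrec positions_pmf :: "nat pmf \<Rightarrow> nat \<Rightarrow> nat \<Rightarrow> nat \<Rightarrow> nat list pmf" where
  "positions_pmf x p k 0 = return_pmf []"
| "positions_pmf x p k (Suc m) = bind_pmf (geometric_pmf (tail x k))
     (\<lambda>d. map_pmf (Cons (Suc (p + d))) (positions_pmf x (Suc (p + d)) (Suc k) m))"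

lemma map_Suc_positions: "map_pmf (map Suc) (positions_pmf x p k m) = positions_pmf x (Suc p) k m"
proof (induction m arbitrary: p k)
  case (Suc m)
  have "map_pmf (map Suc) (map_pmf (Cons (Suc (p + d))) (positions_pmf x (Suc (p + d)) (Suc k) m)) =
      map_pmf (Cons (Suc (Suc p + d))) (positions_pmf x (Suc (Suc p + d)) (Suc k) m)" for d
    using Suc.IH[of "Suc (p + d)" "Suc k", symmetric] by (simp add: pmf.map_comp o_def)
  then show ?case by (simp add: map_bind_pmf)
qed simp

text \<open>Separates the random gap from the common continuation \<open>f\<close>, so that the
  identity for geometric laws can be applied to the gap alone.\<close>

lemma bind_if_bind:
  "bind_pmf p (\<lambda>h. if h then bind_pmf q f else bind_pmf r f) =
   bind_pmf (bind_pmf p (\<lambda>h. if h then q else r)) f"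
  by (auto simp: bind_assoc_pmf intro!: bind_pmf_cong)

lemma tail_convolution:
  assumes "0 < pmf x b" "Suc k \<le> b"
  shows "bind_pmf (bernoulli_pmf (pmf x k / tail x k)) (\<lambda>h. if h
      then bind_pmf (geometric_pmf (tail x k))
             (\<lambda>d. map_pmf (\<lambda>e. Suc (d + e)) (geometric_pmf (tail x (Suc k))))
      else geometric_pmf (tail x k)) = geometric_pmf (tail x (Suc k))"
  using geometric_convolution[of "tail x (Suc k)" "tail x k"] tail_pos[OF assms]
    tail_le_1[of x k] tail_rec[of x k] by simp

text \<open>If the trial at \<open>k\<close> succeeds, the first ball goes and the gaps
  \<open>k\<close> and \<open>Suc k\<close> merge. If it fails, the first gap is kept and, by
  induction, the remaining gaps have parameters from \<open>Suc (Suc k)\<close> on. Mixing both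
  cases gives the first gap parameter \<open>tail x (Suc k)\<close>.\<close>

lemma delete_position:
  assumes "0 < pmf x b" "k + m = b"
  shows "bind_pmf (hazard_pmf x k m)
      (\<lambda>j. map_pmf (\<lambda>ns. take (j - k) ns @ drop (Suc (j - k)) ns) (positions_pmf x p k (Suc m)))
    = positions_pmf x p (Suc k) m"
  using assms(2)
proof (induction m arbitrary: p k)
  case 0
  then show ?case
    by (simp add: bind_return_pmf map_bind_pmf)
next
  case (Suc m)
  let ?g = "\<lambda>k. geometric_pmf (tail x k)"
  \<comment> \<open>The continuation shared by both outcomes of the trial, given \<open>d\<close>
    empty places before the first remaining ball.\<close>
  define F where "F d = map_pmf (Cons (Suc (p + d))) (positions_pmf x (Suc (p + d)) (Suc (Suc k)) m)"
    for d
  define del where "del i ns = take i ns @ drop (Suc i) ns" for i and ns :: "nat list"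
  have del_simps: "del 0 (n # ns) = ns" "del (Suc i) (n # ns) = n # del i ns" for i n ns
    by (simp_all add: del_def)
  let ?D = "\<lambda>j. map_pmf (del (j - k)) (positions_pmf x p k (Suc (Suc m)))"
  have hit: "?D k = bind_pmf
      (bind_pmf (?g k) (\<lambda>d. map_pmf (\<lambda>e. Suc (d + e)) (?g (Suc k)))) F"
    by (simp add: map_bind_pmf pmf.map_comp o_def del_simps bind_assoc_pmf bind_map_pmf F_def
        add_ac)
  have "bind_pmf (hazard_pmf x (Suc k) m) ?D =
      bind_pmf (hazard_pmf x (Suc k) m) (\<lambda>j. bind_pmf (?g k) (\<lambda>d. map_pmf (Cons (Suc (p + d)))
        (map_pmf (del (j - Suc k)) (positions_pmf x (Suc (p + d)) (Suc k) (Suc m)))))"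
  proof (intro bind_pmf_cong refl)
    fix j assume "j \<in> set_pmf (hazard_pmf x (Suc k) m)"
    then have "Suc k \<le> j" by (rule set_hazard_pmf)
    then obtain i where "j = Suc k + i"
      by (rule le_Suc_ex[THEN exE])
    then show "?D j = bind_pmf (?g k) (\<lambda>d. map_pmf (Cons (Suc (p + d)))
        (map_pmf (del (j - Suc k)) (positions_pmf x (Suc (p + d)) (Suc k) (Suc m))))"
      by (simp add: map_bind_pmf pmf.map_comp o_def del_simps Suc_diff_le)
  qed
  also have "\<dots> = bind_pmf (?g k) (\<lambda>d. map_pmf (Cons (Suc (p + d)))
      (bind_pmf (hazard_pmf x (Suc k) m)
        (\<lambda>j. map_pmf (del (j - Suc k)) (positions_pmf x (Suc (p + d)) (Suc k) (Suc m)))))"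
    by (subst bind_commute_pmf) (simp only: map_bind_pmf)
  also have "\<dots> = bind_pmf (?g k) F"
  proof -
    have "bind_pmf (hazard_pmf x (Suc k) m)
        (\<lambda>j. map_pmf (del (j - Suc k)) (positions_pmf x (Suc (p + d)) (Suc k) (Suc m))) =
      positions_pmf x (Suc (p + d)) (Suc (Suc k)) m" for d
      unfolding del_def[abs_def] by (rule Suc.IH) (use Suc.prems in simp)
    then show ?thesis by (simp only: F_def[abs_def])
  qed
  finally have miss: "bind_pmf (hazard_pmf x (Suc k) m) ?D = bind_pmf (?g k) F" .
  have "bind_pmf (hazard_pmf x k (Suc m)) ?D =
    bind_pmf (bernoulli_pmf (pmf x k / tail x k))
      (\<lambda>h. if h then ?D k else bind_pmf (hazard_pmf x (Suc k) m) ?D)"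
    unfolding hazard_pmf.simps bind_assoc_pmf
    by (intro bind_pmf_cong refl) (simp add: bind_return_pmf)
  also have "\<dots> = bind_pmf (?g (Suc k)) F"
    unfolding hit miss bind_if_bind using tail_convolution[of x b k] assms(1) Suc.prems by simp
  also have "\<dots> = positions_pmf x p (Suc k) (Suc m)"
    by (simp add: F_def[abs_def])
  finally show ?case by (simp only: del_def[abs_def])
qed

definition move_position :: "nat \<Rightarrow> nat list \<Rightarrow> nat list" where
  "move_position j ns = (if j = 0 then map Suc ns else 1 # map Suc (take (j - 1) ns @ drop j ns))"

lemma positions_stationary:
  assumes "set_pmf x \<subseteq> {0..b}" "0 < pmf x b" "1 \<le> b"
  shows "bind_pmf x (\<lambda>j. map_pmf (move_position j) (positions_pmf x 0 1 b)) = positions_pmf x 0 1 b"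
proof -
  obtain m where b: "b = Suc m" using assms(3) by (cases b) auto
  let ?D = "\<lambda>j. map_pmf (move_position j) (positions_pmf x 0 1 b)"
  define F where "F d = map_pmf (Cons (Suc d)) (positions_pmf x (Suc d) 2 m)" for d
  have move0: "?D 0 = positions_pmf x 1 1 b"
    using map_Suc_positions[of x 0 1 b] by (simp add: move_position_def[abs_def])
  \<comment> \<open>Since \<open>tail x 0 = 1\<close>, a gap with that parameter is constantly 0.
    Inserting it presents the shift by one as the merging of gaps 0 and 1, and a ball thrown to
    position 1 as a first gap of index 0, so \<open>tail_convolution\<close> applies with
    \<open>k = 0\<close>.\<close>
  have hit: "?D 0 = bind_pmf
      (bind_pmf (geometric_pmf (tail x 0)) (\<lambda>d. map_pmf (\<lambda>e. Suc (d + e)) (geometric_pmf (tail x 1)))) F"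
    unfolding move0
    by (simp add: b bind_assoc_pmf bind_map_pmf bind_return_pmf F_def numeral_2_eq_2)
  have "bind_pmf (hazard_pmf x 1 m) ?D = bind_pmf (hazard_pmf x 1 m) (\<lambda>j.
      map_pmf (\<lambda>ns. 1 # map Suc ns) (map_pmf (\<lambda>ns. take (j - 1) ns @ drop (Suc (j - 1)) ns)
        (positions_pmf x 0 1 (Suc m))))"
  proof (intro bind_pmf_cong refl)
    fix j assume "j \<in> set_pmf (hazard_pmf x 1 m)"
    then have "1 \<le> j" by (rule set_hazard_pmf)
    then show "?D j = map_pmf (\<lambda>ns. 1 # map Suc ns)
        (map_pmf (\<lambda>ns. take (j - 1) ns @ drop (Suc (j - 1)) ns) (positions_pmf x 0 1 (Suc m)))"
      by (simp add: pmf.map_comp o_def b move_position_def[abs_def] del: positions_pmf.simps)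
  qed
  also have "\<dots> = map_pmf (\<lambda>ns. 1 # map Suc ns) (positions_pmf x 0 (Suc 1) m)"
    unfolding map_bind_pmf[symmetric]
    by (subst delete_position[of x b]) (use assms(2) b in simp_all)
  also have "\<dots> = map_pmf (Cons 1) (map_pmf (map Suc) (positions_pmf x 0 2 m))"
    by (simp add: pmf.map_comp o_def numeral_2_eq_2)
  also have "\<dots> = bind_pmf (geometric_pmf (tail x 0)) F"
    unfolding map_Suc_positions by (simp add: F_def bind_return_pmf)
  finally have miss: "bind_pmf (hazard_pmf x 1 m) ?D = bind_pmf (geometric_pmf (tail x 0)) F" .
  have "bind_pmf (hazard_pmf x 0 b) ?D =
    bind_pmf (bernoulli_pmf (pmf x 0 / tail x 0))
      (\<lambda>h. if h then ?D 0 else bind_pmf (hazard_pmf x 1 m) ?D)"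
    unfolding b hazard_pmf.simps bind_assoc_pmf
    by (intro bind_pmf_cong refl) (simp add: bind_return_pmf)
  also have "\<dots> = bind_pmf (geometric_pmf (tail x 1)) F"
    unfolding hit miss bind_if_bind
    by (subst tail_convolution[of x b 0, folded One_nat_def]) (use assms in simp_all)
  also have "\<dots> = positions_pmf x 0 1 b"
    by (simp add: F_def[abs_def] b numeral_2_eq_2)
  finally show ?thesis
    by (simp add: hazard_pmf_eq[OF assms(1,2)])
qed

lemma set_positions_pmf:
  "ns \<in> set_pmf (positions_pmf x p k m) \<Longrightarrow>
    length ns = m \<and> sorted_wrt (<) ns \<and> (\<forall>n\<in>set ns. p < n)"
  by (induction m arbitrary: p k ns) (fastforce)+

lemma pmf_positions:
  assumes "0 < pmf x b" "k + m \<le> Suc b" "length ns = m" "sorted_wrt (<) ns" "\<forall>n\<in>set ns. p < n"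
  shows "pmf (positions_pmf x p k m) ns =
    (\<Prod>i<m. (1 - tail x (k + i)) ^ ((p # ns) ! Suc i - (p # ns) ! i - 1)) * (\<Prod>i<m. tail x (k + i))"
  using assms(2-)
proof (induction m arbitrary: p k ns)
  case (Suc m)
  obtain n ns' where ns: "ns = n # ns'"
    using Suc.prems(2) by (cases ns) auto
  let ?N = "\<lambda>d. map_pmf (Cons (Suc (p + d))) (positions_pmf x (Suc (p + d)) (Suc k) m)"
  define d where "d = n - p - 1"
  have n: "n = Suc (p + d)"
    using Suc.prems(4) by (simp add: ns d_def)
  have N: "pmf (?N e) ns = (if e = d then pmf (positions_pmf x n (Suc k) m) ns' else 0)" for e
  proof (cases "e = d")
    case True
    then show ?thesis
      by (simp add: ns n pmf_map_inj')
  next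
    case False
    then show ?thesis
      by (auto simp: ns n pmf_eq_0_set_pmf)
  qed
  have t: "0 < tail x k"
    using assms(1) Suc.prems(1) by (intro tail_pos) auto
  have "pmf (positions_pmf x p k (Suc m)) ns =
      (\<Sum>e\<in>{d}. pmf (?N e) ns * pmf (geometric_pmf (tail x k)) e)"
    unfolding positions_pmf.simps pmf_bind
    by (rule integral_measure_pmf_real) (auto simp: N split: if_splits)
  also have "\<dots> = (1 - tail x k) ^ d * tail x k * pmf (positions_pmf x n (Suc k) m) ns'"
    using t tail_le_1[of x k] by (simp add: N)
  also have "pmf (positions_pmf x n (Suc k) m) ns' =
      (\<Prod>i<m. (1 - tail x (Suc k + i)) ^ ((n # ns') ! Suc i - (n # ns') ! i - 1)) *
      (\<Prod>i<m. tail x (Suc k + i))"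
    using Suc.prems by (intro Suc.IH) (auto simp: ns)
  finally show ?case
    unfolding prod.lessThan_Suc_shift by (simp add: ns d_def)
qed simp

section \<open>Uniqueness of stationary distributions\<close>

text \<open>
  For the set $A$ of states with $p > q$, the terms $(p(s) - q(s))(1_A(s) - K(s, A))$ are
  nonnegative and sum to zero, so $A$ is closed under $K$.
\<close>

lemma stationary_greater_closed:
  assumes p: "bind_pmf p K = p" and q: "bind_pmf q K = q"
    and s: "pmf q s < pmf p s" and t: "t \<in> set_pmf (K s)"
  shows "pmf q t < pmf p t"
proof -
  define A where "A = {s. pmf q s < pmf p s}"
  define g :: "_ \<Rightarrow> real" where "g s = indicator A s - measure_pmf.prob (K s) A" for s
  have g_le: "\<bar>g s\<bar> \<le> 1" for s
  proof -
    have "0 \<le> measure_pmf.prob (K s) A" "measure_pmf.prob (K s) A \<le> 1"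
      by simp_all
    moreover have "indicator A s = (0::real) \<or> indicator A s = (1::real)"
      by (simp add: indicator_def)
    ultimately show ?thesis
      unfolding g_def by linarith
  qed
  have int: "integrable (measure_pmf r) g" for r
    by (rule measure_pmf.integrable_const_bound[where B = 1]) (use g_le in auto)
  \<comment> \<open>Stationarity says that r(A) is the mean of K(s, A) under \<open>r\<close>, so
    \<open>g\<close> has mean zero.\<close>
  have zero: "(\<integral>s. g s \<partial>measure_pmf r) = 0" if "bind_pmf r K = r" for r
  proof -
    have int_K: "integrable (measure_pmf r) (\<lambda>s. measure_pmf.prob (K s) A)"
      by (rule measure_pmf.integrable_const_bound[where B = 1]) auto
    have "ennreal (measure_pmf.prob r A) = emeasure (bind_pmf r K) A"
      using that by (simp add: measure_pmf.emeasure_eq_measure)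
    also have "\<dots> = (\<integral>\<^sup>+s. ennreal (measure_pmf.prob (K s) A) \<partial>measure_pmf r)"
      unfolding emeasure_bind_pmf by (simp add: measure_pmf.emeasure_eq_measure)
    also have "\<dots> = ennreal (\<integral>s. measure_pmf.prob (K s) A \<partial>measure_pmf r)"
      using int_K by (intro nn_integral_eq_integral) auto
    finally have "measure_pmf.prob r A = (\<integral>s. measure_pmf.prob (K s) A \<partial>measure_pmf r)"
      by (simp add: integral_nonneg_AE)
    then show ?thesis
      unfolding g_def using int_K
      by (subst Bochner_Integration.integral_diff)
        (auto intro!: measure_pmf.integrable_const_bound[where B = 1])
  qed
  have dens: "integrable (count_space UNIV) (\<lambda>s. pmf r s * g s) \<and>
      (\<integral>s. pmf r s * g s \<partial>count_space UNIV) = (\<integral>s. g s \<partial>measure_pmf r)" for r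
    using int[of r] unfolding measure_pmf_eq_density
    by (simp add: integrable_density integral_density)
  have nonneg: "0 \<le> pmf p s * g s - pmf q s * g s" for s
  proof (cases "s \<in> A")
    case True
    then have "0 \<le> (pmf p s - pmf q s) * g s"
      by (intro mult_nonneg_nonneg) (auto simp: A_def g_def)
    then show ?thesis by (simp add: algebra_simps)
  next
    case False
    then have "0 \<le> (pmf p s - pmf q s) * g s"
      by (intro mult_nonpos_nonpos) (auto simp: A_def g_def)
    then show ?thesis by (simp add: algebra_simps)
  qed
  have "(\<integral>s. (pmf p s * g s - pmf q s * g s) \<partial>count_space UNIV) = 0"
    using dens[of p] dens[of q] zero[OF p] zero[OF q] by simp
  then have "AE s in count_space UNIV. pmf p s * g s - pmf q s * g s = 0"
    using dens[of p] dens[of q] nonneg by (subst (asm) integral_nonneg_eq_0_iff_AE) auto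
  then have "(pmf p s - pmf q s) * g s = 0"
    by (simp add: AE_count_space algebra_simps)
  then have "measure_pmf.prob (K s) A = 1"
    using s by (simp add: g_def A_def)
  then have "set_pmf (K s) \<subseteq> A"
    by (simp add: measure_pmf.prob_eq_1 AE_measure_pmf_iff subset_eq)
  then show ?thesis
    using t by (auto simp: A_def)
qed

text \<open>Two different probability laws exceed each other somewhere. Both strict inequalities
  propagate along transitions to the common state \<open>s0\<close>, where they contradict each
  other.\<close>

lemma stationary_unique:
  assumes "bind_pmf p K = p" "bind_pmf q K = q"
    and reach: "\<And>s. s \<in> set_pmf p \<union> set_pmf q \<Longrightarrow> (s, s0) \<in> {(s, t). t \<in> set_pmf (K s)}\<^sup>*"
  shows "p = q"
proof -
  have closed: "pmf q' s0 < pmf p' s0"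
    if "bind_pmf p' K = p'" "bind_pmf q' K = q'" "pmf q' s < pmf p' s"
      "(s, s0) \<in> {(s, t). t \<in> set_pmf (K s)}\<^sup>*" for p' q' s
    using that(4)
    by (induction rule: rtrancl_induct) (use that(1-3) stationary_greater_closed in fast)+
  have pos: "s \<in> set_pmf r" if "pmf r' s < pmf r s" for r r' :: "'a pmf" and s
    using that pmf_nonneg[of r' s] by (auto simp: set_pmf_iff)
  show "p = q"
  proof (rule ccontr)
    assume "p \<noteq> q"
    then obtain s t where "pmf q s < pmf p s" "pmf p t < pmf q t"
      using pmf_neq_exists_less[of q p] pmf_neq_exists_less[of p q] by metis
    then have "pmf q s0 < pmf p s0" "pmf p s0 < pmf q s0"
      using closed[of p q s] closed[of q p t] assms pos by blast+
    then show False by simp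
  qed
qed

section \<open>The juggling chain\<close>

definition insert_once :: "nat \<Rightarrow> nat list \<Rightarrow> nat list" where
  "insert_once x ys = (case ys of [] \<Rightarrow> [x] | y # zs \<Rightarrow> min x y # max x y # zs)"

text \<open>One pass of bubble sort from right to left; the head of the intermediate list is the
  label being carried.\<close>

definition bubble :: "nat list \<Rightarrow> nat list" where
  "bubble xs = foldr insert_once xs []"

lemma insert_once_simps [simp]:
  "insert_once x [] = [x]"
  "insert_once x (y # zs) = min x y # max x y # zs"
  by (simp_all add: insert_once_def)

lemma bubble_simps [simp]:
  "bubble [] = []"
  "bubble (x # xs) = insert_once x (bubble xs)"
  by (simp_all add: bubble_def)

lemma mset_insert_once [simp]: "mset (insert_once x ys) = add_mset x (mset ys)"
  by (cases ys) (auto simp: min_def max_def)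

lemma mset_bubble [simp]: "mset (bubble xs) = mset xs"
  by (induction xs) auto

lemma length_bubble [simp]: "length (bubble xs) = length xs"
  by (metis mset_bubble size_mset)

lemma bubble_sorted: "sorted xs \<Longrightarrow> bubble xs = xs"
proof (induction xs)
  case (Cons x xs)
  then show ?case by (cases xs) auto
qed simp

text \<open>The sum of the entries, each multiplied by its index counted from 0; it serves as a
  progress measure for sorting.\<close>

primrec moment :: "nat list \<Rightarrow> nat" where
  "moment [] = 0"
| "moment (x # xs) = moment xs + sum_list xs"

lemma moment_le: "moment xs \<le> length xs * sum_list xs"
proof (induction xs)
  case (Cons x xs)
  then show ?case by (simp add: algebra_simps)
qed simp

text \<open>An exchange of \<open>x\<close> with a smaller head \<open>y\<close> moves the larger
  label to the right and gains \<open>x - y\<close>. Without an exchange, equality is inherited by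
  the tail, which is then sorted with head at least \<open>x\<close>.\<close>

lemma moment_bubble: "moment xs \<le> moment (bubble xs) \<and>
  (moment (bubble xs) = moment xs \<longrightarrow> sorted xs)"
proof (induction xs)
  case (Cons x xs)
  have sum: "sum_list (bubble xs) = sum_list xs"
    by (metis mset_bubble sum_mset_sum_list)
  show ?case
  proof (cases "bubble xs")
    case Nil
    then have "xs = []" by (metis length_0_conv length_bubble)
    then show ?thesis by simp
  next
    case (Cons y ys)
    have eq: "moment (bubble (x # xs)) = moment ys + max x y + 2 * sum_list ys"
      using Cons by simp
    have "moment (bubble xs) = moment ys + sum_list ys" "sum_list xs = y + sum_list ys"
      using Cons sum by simp_all
    moreover have "sorted (x # xs)" if "x \<le> y" "sorted xs"
      using that Cons bubble_sorted[of xs] by (auto simp: order_trans)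
    ultimately show ?thesis
      using Cons.IH unfolding eq by (cases "x \<le> y") auto
  qed
qed simp

lemma bubble_iterate_sorted: "\<exists>n. sorted ((bubble ^^ n) xs)"
proof (induction "length xs * sum_list xs - moment xs" arbitrary: xs rule: less_induct)
  case less
  show ?case
  proof (cases "sorted xs")
    case True
    then show ?thesis by (intro exI[of _ 0]) simp
  next
    case False
    have "sum_list (bubble xs) = sum_list xs"
      by (metis mset_bubble sum_mset_sum_list)
    then have "length (bubble xs) * sum_list (bubble xs) - moment (bubble xs)
        < length xs * sum_list xs - moment xs"
      using False moment_bubble[of xs] moment_le[of "bubble xs"] by force
    then obtain n where "sorted ((bubble ^^ n) (bubble xs))"
      using less by blast
    then show ?thesis
      by (intro exI[of _ "Suc n"]) (simp add: funpow_Suc_right del: funpow.simps)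
  qed
qed

section \<open>Reachability of the sorted state\<close>

lemma foldr_insert_once_slide:
  assumes "\<And>s. 0 < \<alpha> s \<and> \<alpha> s < 1"
  shows "foldr insert_once u (y # ys) \<in> set_pmf (slide \<alpha> (length u) (u @ y # ys))"
proof (induction u arbitrary: y ys rule: rev_induct)
  case (snoc c u)
  \<comment> \<open>For \<open>c < y\<close> the trial fails with positive probability and
    \<open>c\<close> is bumped; otherwise the exchange is certain. In both cases the smaller label
    is carried on.\<close>
  have "u @ min c y # max c y # ys \<in> set_pmf (adjacent_step \<alpha> (length u) (u @ c # y # ys))"
  proof (cases "c < y")
    case True
    have "pmf (bernoulli_pmf (\<alpha> (Suc (num_less ys y)))) False \<noteq> 0"
      using assms[of "Suc (num_less ys y)"] by simp
    then have "False \<in> set_pmf (bernoulli_pmf (\<alpha> (Suc (num_less ys y))))"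
      by (simp add: set_pmf_iff)
    then show ?thesis
      using True by (force simp: adjacent_step_append)
  qed (auto simp: adjacent_step_append)
  then show ?case
    using snoc.IH[of "min c y" "max c y # ys"] by (auto intro!: bexI)
qed simp

lemma bubble_bump:
  assumes "\<And>s. 0 < \<alpha> s \<and> \<alpha> s < 1" "\<tau> \<noteq> []"
  shows "bubble \<tau> \<in> set_pmf (bump \<alpha> \<tau> (length \<tau>))"
proof -
  obtain u y where \<tau>: "\<tau> = u @ [y]"
    using assms(2) by (metis rev_exhaust)
  have "bump \<alpha> \<tau> (length \<tau>) = slide \<alpha> (length u) \<tau>"
    by (subst bump_eq_slide) (use assms(1) in \<open>auto simp: \<tau> intro: less_imp_le\<close>)
  then show ?thesis
    using foldr_insert_once_slide[OF assms(1), of u y "[]"] by (simp add: \<tau> bubble_def)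
qed

lemma imrjmc_step_move_position:
  "imrjmc_step x \<alpha> (\<tau>, ns) = bind_pmf x (\<lambda>j. map_pmf (\<lambda>\<tau>'. (\<tau>', move_position j ns))
     (if j = 0 then return_pmf \<tau> else bump \<alpha> \<tau> j))"
  by (auto simp: imrjmc_step_def move_position_def intro!: bind_pmf_cong)

text \<open>One of the possible outcomes of throwing the last ball, which has positive probability
  because x_b > 0.\<close>

definition last_to_front :: "nat list \<times> nat list \<Rightarrow> nat list \<times> nat list" where
  "last_to_front = (\<lambda>(\<tau>, ns). (bubble \<tau>, move_position (length ns) ns))"

lemma length_move_position:
  "j \<le> length ns \<Longrightarrow> length (move_position j ns) = length ns"
  by (auto simp: move_position_def)

lemma funpow_last_to_front:
  assumes "length \<tau> = b" "length ns = b"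
  shows "(last_to_front ^^ n) (\<tau>, ns) = ((bubble ^^ n) \<tau>, (move_position b ^^ n) ns) \<and>
    length ((bubble ^^ n) \<tau>) = b \<and> length ((move_position b ^^ n) ns) = b"
  by (induction n) (auto simp: assms last_to_front_def length_move_position)

text \<open>Every throw of the last ball puts a new ball at position 1 and shifts the earlier ones
  by one, so the initial positions are forgotten after \<open>b\<close> throws.\<close>

lemma take_move_position:
  assumes "length ns = b" "n \<le> b"
  shows "take n ((move_position b ^^ n) ns) = [1..<Suc n] \<and>
    length ((move_position b ^^ n) ns) = b"
  using assms(2)
proof (induction n)
  case (Suc n)
  let ?ms = "(move_position b ^^ n) ns"
  have "take (Suc n) (move_position b ?ms) = 1 # map Suc (take n ?ms)"
    using Suc by (cases b) (auto simp: move_position_def take_map)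
  also have "\<dots> = [1..<Suc (Suc n)]"
    using Suc by (simp add: map_Suc_upt upt_conv_Cons del: upt_Suc)
  finally show ?case
    using Suc by (simp add: length_move_position del: upt_Suc)
qed (simp add: assms)

lemma imrjmc_reaches_sorted:
  assumes \<alpha>: "\<And>s. 0 < \<alpha> s \<and> \<alpha> s < 1" and b: "0 < pmf x (size M)" "M \<noteq> {#}"
    and s: "s \<in> imrjmc_states M"
  shows "(s, (sorted_list_of_multiset M, [1..<Suc (size M)])) \<in>
    {(s, t). t \<in> set_pmf (imrjmc_step x \<alpha> s)}\<^sup>*"
proof -
  let ?R = "{(s, t). t \<in> set_pmf (imrjmc_step x \<alpha> s)}"
  define b where "b = size M"
  obtain \<tau> ns where s_eq: "s = (\<tau>, ns)" by (cases s)
  have \<tau>: "mset \<tau> = M" and ns: "length ns = b"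
    using s by (auto simp: s_eq imrjmc_states_def b_def permutations_of_multiset_def)
  have len: "length \<tau> = b"
    using \<tau> by (auto simp: b_def)
  have "0 < b"
    using assms(3) by (simp add: b_def nonempty_has_size)
  have step: "((\<tau>', ns'), last_to_front (\<tau>', ns')) \<in> ?R"
    if "length \<tau>' = b" "length ns' = b" for \<tau>' ns'
  proof -
    have "b \<in> set_pmf x"
      using assms(2) by (simp add: b_def set_pmf_iff)
    moreover have "bubble \<tau>' \<in> set_pmf (bump \<alpha> \<tau>' b)"
      using bubble_bump[OF \<alpha>, of \<tau>'] that \<open>0 < b\<close> by auto
    ultimately show ?thesis
      using \<open>0 < b\<close> that
      by (auto simp: imrjmc_step_move_position last_to_front_def intro!: bexI[of _ b])
  qed
  have reach: "(s, (last_to_front ^^ n) s) \<in> ?R\<^sup>*" for n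
  proof (induction n)
    case (Suc n)
    show ?case
      using Suc step funpow_last_to_front[OF len ns, of n]
      by (auto simp: s_eq intro: rtrancl.rtrancl_into_rtrancl)
  qed simp
  obtain n where n: "sorted ((bubble ^^ n) \<tau>)"
    using bubble_iterate_sorted by blast
  \<comment> \<open>After \<open>n\<close> throws the labels are sorted and further passes fix them,
    so another \<open>b\<close> throws only drive the positions to 1, ..., \<open>b\<close>.\<close>
  have "(bubble ^^ k) ((bubble ^^ n) \<tau>) = (bubble ^^ n) \<tau>" for k
    by (induction k) (simp_all add: bubble_sorted n)
  then have "(bubble ^^ (b + n)) \<tau> = (bubble ^^ n) \<tau>"
    by (simp add: funpow_add)
  moreover have "mset ((bubble ^^ n) \<tau>) = M"
    by (induction n) (simp_all add: \<tau>)
  then have "(bubble ^^ n) \<tau> = sorted_list_of_multiset M"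
    using n by (metis sorted_list_of_multiset_mset sorted_sort_id)
  moreover have "(move_position b ^^ (b + n)) ns = [1..<Suc b]"
    using take_move_position[of "(move_position b ^^ n) ns" b b] funpow_last_to_front[OF len ns, of n]
    by (metis comp_apply funpow_add order_refl take_all)
  ultimately show ?thesis
    using reach[of "b + n"] funpow_last_to_front[OF len ns, of "b + n"]
    by (simp add: s_eq b_def del: upt_Suc)
qed

section \<open>The product law and its relation to the weight\<close>

lemma imrjmc_stationary:
  assumes \<alpha>: "\<And>s. 0 < \<alpha> s \<and> \<alpha> s < 1"
    and x: "set_pmf x \<subseteq> {0..size M}" "0 < pmf x (size M)" and M: "M \<noteq> {#}"
  shows "bind_pmf (pair_pmf (multiperm_pmf \<alpha> M) (positions_pmf x 0 1 (size M))) (imrjmc_step x \<alpha>) =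
    pair_pmf (multiperm_pmf \<alpha> M) (positions_pmf x 0 1 (size M))"
proof -
  let ?p = "multiperm_pmf \<alpha> M" and ?q = "positions_pmf x 0 1 (size M)"
  have b: "1 \<le> size M"
    using M by (simp add: Suc_le_eq nonempty_has_size)
  \<comment> \<open>The key to decoupling: for every fixed \<open>j\<close> the labels keep their
    law. Averaging over \<open>\<tau>\<close> before \<open>j\<close> therefore removes all
    dependence between new labels and new positions.\<close>
  have inner: "bind_pmf ?p (\<lambda>\<tau>. map_pmf (\<lambda>\<tau>'. (\<tau>', ms)) (if j = 0 then return_pmf \<tau> else bump \<alpha> \<tau> j)) =
      map_pmf (\<lambda>\<tau>'. (\<tau>', ms)) ?p" if "j \<in> set_pmf x" for j ms
  proof (cases "j = 0")
    case True
    then show ?thesis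
      by (simp add: map_pmf_def bind_return_pmf)
  next
    case False
    then have "bind_pmf ?p (\<lambda>\<tau>. bump \<alpha> \<tau> j) = ?p"
      using that x(1) by (intro bind_multiperm_bump[OF \<alpha>]) auto
    then show ?thesis
      using False by (simp flip: map_bind_pmf)
  qed
  have "bind_pmf (pair_pmf ?p ?q) (imrjmc_step x \<alpha>) =
    bind_pmf ?p (\<lambda>\<tau>. bind_pmf ?q (\<lambda>ns. bind_pmf x (\<lambda>j. map_pmf (\<lambda>\<tau>'. (\<tau>', move_position j ns))
     (if j = 0 then return_pmf \<tau> else bump \<alpha> \<tau> j))))"
    by (simp add: pair_pmf_def bind_assoc_pmf bind_return_pmf imrjmc_step_move_position)
  also have "\<dots> = bind_pmf ?q (\<lambda>ns. bind_pmf ?p (\<lambda>\<tau>. bind_pmf x (\<lambda>j. map_pmf (\<lambda>\<tau>'. (\<tau>', move_position j ns))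
     (if j = 0 then return_pmf \<tau> else bump \<alpha> \<tau> j))))"
    by (rule bind_commute_pmf)
  also have "\<dots> = bind_pmf ?q (\<lambda>ns. bind_pmf x (\<lambda>j. bind_pmf ?p (\<lambda>\<tau>. map_pmf (\<lambda>\<tau>'. (\<tau>', move_position j ns))
     (if j = 0 then return_pmf \<tau> else bump \<alpha> \<tau> j))))"
    by (intro bind_pmf_cong refl) (rule bind_commute_pmf)
  also have "\<dots> = bind_pmf ?q (\<lambda>ns. bind_pmf x (\<lambda>j. map_pmf (\<lambda>\<tau>'. (\<tau>', move_position j ns)) ?p))"
    by (intro bind_pmf_cong refl inner)
  also have "\<dots> = bind_pmf (bind_pmf x (\<lambda>j. map_pmf (move_position j) ?q)) (\<lambda>ns. map_pmf (\<lambda>\<tau>'. (\<tau>', ns)) ?p)"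
    by (subst bind_commute_pmf) (simp add: bind_assoc_pmf bind_map_pmf)
  also have "\<dots> = bind_pmf ?q (\<lambda>ns. map_pmf (\<lambda>\<tau>'. (\<tau>', ns)) ?p)"
    using positions_stationary[OF x b] by simp
  also have "\<dots> = pair_pmf ?p ?q"
    unfolding pair_pmf_def map_pmf_def by (rule bind_commute_pmf)
  finally show ?thesis .
qed

lemma set_pmf_subset_imrjmc_states:
  assumes "\<And>s. 0 < \<alpha> s"
  shows "set_pmf (pair_pmf (multiperm_pmf \<alpha> M) (positions_pmf x 0 1 (size M))) \<subseteq> imrjmc_states M"
proof (clarsimp simp: imrjmc_states_def, intro conjI)
  fix \<tau> ns
  assume "\<tau> \<in> set_pmf (multiperm_pmf \<alpha> M)"
    and "ns \<in> set_pmf (positions_pmf x 0 (Suc 0) (size M))"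
  then show "\<tau> \<in> permutations_of_multiset M" "length ns = size M" "sorted_wrt (<) ns"
    "\<forall>n\<in>set ns. Suc 0 \<le> n"
    using set_multiperm_pmf[of \<alpha> M, OF assms] set_positions_pmf[of ns x 0 "Suc 0" "size M"]
    by (auto simp: Suc_le_eq)
qed

text \<open>The weight differs from the product law only by state-independent constants: the total
  code weight, and one success factor \<open>tail x k\<close> for each geometric gap.\<close>

lemma imrjmc_weight_eq_pmf:
  assumes \<alpha>: "\<And>s. 0 < \<alpha> s" and x: "0 < pmf x (size M)" and s: "s \<in> imrjmc_states M"
  shows "imrjmc_weight x \<alpha> s =
    (\<Sum>\<sigma>\<in>permutations_of_multiset M. code_weight \<alpha> \<sigma>) / (\<Prod>i<size M. tail x (Suc i)) *
    pmf (pair_pmf (multiperm_pmf \<alpha> M) (positions_pmf x 0 1 (size M))) s"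
proof -
  obtain \<tau> ns where s_eq: "s = (\<tau>, ns)" by (cases s)
  have ns: "length ns = size M" "sorted_wrt (<) ns" "\<forall>n\<in>set ns. 0 < n"
    and \<tau>: "\<tau> \<in> permutations_of_multiset M"
    using s by (auto simp: s_eq imrjmc_states_def Suc_le_eq)
  define P where "P = (\<Prod>i<size M. tail x (Suc i))"
  have "0 < P"
    unfolding P_def by (intro prod_pos) (auto intro: tail_pos[OF x])
  moreover have "(\<Sum>\<sigma>\<in>permutations_of_multiset M. code_weight \<alpha> \<sigma>) \<noteq> 0"
    using sum_code_weight_pos[of \<alpha> M, OF \<alpha>] by simp
  moreover have "(\<Prod>k=1..length ns. (\<Sum>i\<le>k - 1. pmf x i) ^ (entry ns k - entry ns (k - 1) - 1)) =
    (\<Prod>i<size M. (1 - tail x (1 + i)) ^ ((0 # ns) ! Suc i - (0 # ns) ! i - 1))"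
    by (simp add: ns prod.atLeast1_atMost_eq one_minus_tail entry_def)
  moreover have "pmf (positions_pmf x 0 1 (size M)) ns =
    (\<Prod>i<size M. (1 - tail x (1 + i)) ^ ((0 # ns) ! Suc i - (0 # ns) ! i - 1)) *
    P"
    using pmf_positions[of x "size M" 1 "size M" ns 0] x ns by (simp add: P_def)
  ultimately show ?thesis
    unfolding s_eq imrjmc_weight_def pmf_pair P_def[symmetric]
    by (simp add: pmf_multiperm[OF \<alpha>] \<tau>)
qed

section \<open>The finitely many parameters that the chain consults\<close>

lemma bump_prob_cong:
  assumes "\<And>s. 1 \<le> s \<Longrightarrow> s \<le> l \<Longrightarrow> \<alpha> (r + s) = \<beta> (r + s)"
  shows "bump_prob \<alpha> l r k = bump_prob \<beta> l r k"
proof -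
  have "\<alpha> (r + l - k + 1) = \<beta> (r + l - k + 1)" if "1 \<le> k" "k \<le> l"
    using assms[of "l - k + 1"] that by simp
  then show ?thesis
    unfolding bump_prob_def
    using assms by (auto intro!: prod.cong arg_cong2[where f = "(*)"])
qed

lemma bump_path_cong:
  assumes "\<And>i s. 1 \<le> i \<Longrightarrow> i \<le> length \<tau> \<Longrightarrow> 1 \<le> s \<Longrightarrow>
      s \<le> smaller_right \<tau> i + length (smaller_left \<tau> i) \<Longrightarrow> \<alpha> s = \<beta> s"
    and "1 \<le> j" "j \<le> length \<tau>"
  shows "bump_path \<alpha> \<tau> j w = bump_path \<beta> \<tau> j w"
  using assms(2,3)
proof (induction j arbitrary: w rule: less_induct)
  case (less j)
  have "bump_prob \<alpha> (length (smaller_left \<tau> j)) (smaller_right \<tau> j) k =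
    bump_prob \<beta> (length (smaller_left \<tau> j)) (smaller_right \<tau> j) k" for k
    using less.prems by (intro bump_prob_cong assms(1)[of j]) auto
  then have "bump_choice \<alpha> (length (smaller_left \<tau> j)) (smaller_right \<tau> j) =
      bump_choice \<beta> (length (smaller_left \<tau> j)) (smaller_right \<tau> j)"
    unfolding bump_choice_def by (intro arg_cong[where f = embed_pmf] ext)
  then show ?case
    using less.IH less.prems
    by (subst (1 2) bump_path.simps) (auto simp: Let_def intro!: bind_pmf_cong)
qed

text \<open>A ball with the maximal label \<open>T\<close> is not smaller than any ball. This is the
  origin of the bound b - b_T on the parameter indices.\<close>

lemma num_less_le:
  assumes "a \<in> set \<tau>" "set \<tau> \<subseteq> {..T}"
  shows "num_less \<tau> a \<le> length \<tau> - count (mset \<tau>) T"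
proof -
  have "num_less \<tau> a \<le> size (filter_mset (\<lambda>c. c \<noteq> T) (mset \<tau>))"
    unfolding num_less_def size_mset[symmetric] mset_filter
    using assms by (intro size_mset_mono filter_mset_mono_strong) auto
  also have "\<dots> = length \<tau> - count (mset \<tau>) T"
  proof -
    have "length \<tau> = size (filter_mset (\<lambda>c. c = T) (mset \<tau>)) + size (filter_mset (\<lambda>c. c \<noteq> T) (mset \<tau>))"
      by (metis multiset_partition size_mset size_union)
    then show ?thesis by (simp add: filter_eq_replicate_mset)
  qed
  finally show ?thesis .
qed

lemma length_smaller_left:
  assumes "1 \<le> i" "i \<le> length \<tau>"
  shows "length (smaller_left \<tau> i) = num_less (take (i - 1) \<tau>) (entry \<tau> i)"
proof -
  have "take (i - 1) \<tau> = map (entry \<tau>) [1..<i]"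
    using assms by (intro nth_equalityI) (auto simp: entry_def)
  then show ?thesis
    by (simp add: num_less_def smaller_left_def filter_map o_def)
qed

text \<open>A choice consults parameters only up to index r + l, so \<open>num_less_le\<close>
  bounds the indices used along a bumping path.\<close>

lemma smaller_right_left:
  assumes "1 \<le> i" "i \<le> length \<tau>"
  shows "smaller_right \<tau> i + length (smaller_left \<tau> i) = num_less \<tau> (entry \<tau> i)"
proof -
  obtain n where n: "i = Suc n" using assms by (cases i) auto
  have "\<tau> = take n \<tau> @ entry \<tau> i # drop i \<tau>"
    using assms by (simp add: n entry_def id_take_nth_drop)
  then have "num_less \<tau> (entry \<tau> i) =
      num_less (take n \<tau> @ entry \<tau> i # drop i \<tau>) (entry \<tau> i)"
    by simp
  then show ?thesis
    using assms by (simp add: length_smaller_left smaller_right_eq n)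
qed

lemma code_weight_cong:
  assumes "\<And>s. 1 \<le> s \<Longrightarrow> s \<le> N \<Longrightarrow> \<alpha> s = \<beta> s"
    and "\<And>a. a \<in> set \<tau> \<Longrightarrow> num_less \<tau> a \<le> N"
  shows "code_weight \<alpha> \<tau> = code_weight \<beta> \<tau>"
  using assms(2)
proof (induction \<tau>)
  case (Cons a \<tau>)
  have "num_less \<tau> c \<le> N" if "c \<in> set (a # \<tau>)" for c
    using Cons.prems[OF that] by (auto split: if_splits)
  moreover from this[of a] have "(\<Prod>s=1..num_less \<tau> a. \<alpha> s) = (\<Prod>s=1..num_less \<tau> a. \<beta> s)"
    by (intro prod.cong refl assms(1)) auto
  ultimately show ?case
    using Cons.IH by (simp add: code_weight_Cons)
qed simp

lemma imrjmc_step_cong: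
  assumes "\<And>s. 1 \<le> s \<Longrightarrow> s \<le> N \<Longrightarrow> \<alpha> s = \<beta> s"
    and "\<And>a. a \<in> set \<tau> \<Longrightarrow> num_less \<tau> a \<le> N"
    and "set_pmf x \<subseteq> {0..length \<tau>}"
  shows "imrjmc_step x \<alpha> (\<tau>, ns) = imrjmc_step x \<beta> (\<tau>, ns)"
proof -
  have "bump \<alpha> \<tau> j = bump \<beta> \<tau> j" if "1 \<le> j" "j \<le> length \<tau>" for j
    unfolding bump_def
  proof (rule arg_cong[where f = "map_pmf _"], rule bump_path_cong[OF _ that])
    fix i s
    assume *: "1 \<le> i" "i \<le> length \<tau>" "1 \<le> s" "s \<le> smaller_right \<tau> i + length (smaller_left \<tau> i)"
    have "entry \<tau> i \<in> set \<tau>"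
      using * by (cases i) (auto simp: entry_def)
    then show "\<alpha> s = \<beta> s"
      using assms(1)[of s] assms(2)[of "entry \<tau> i"] * smaller_right_left[of i \<tau>] by simp
  qed
  then show ?thesis
    using assms(3) unfolding imrjmc_step_def by (auto intro!: bind_pmf_cong)
qed

lemma stationary_distribution_cong:
  assumes "\<And>s. s \<in> S \<Longrightarrow> K s = K' s"
  shows "stationary_distribution S K p \<longleftrightarrow> stationary_distribution S K' p"
proof -
  have "bind_pmf p K = bind_pmf p K'" if "set_pmf p \<subseteq> S"
    using assms that by (intro bind_pmf_cong) auto
  then show ?thesis
    by (auto simp: stationary_distribution_def)
qed

section \<open>Normalizing constant and stationary distribution\<close>

lemma has_sum_pmf:
  assumes "set_pmf p \<subseteq> S"
  shows "(pmf p has_sum 1) S"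
proof -
  have "pmf p summable_on S"
    using pmf_abs_summable[of p S] abs_summable_equivalent abs_summable_summable by blast
  moreover have "infsum (pmf p) S = 1"
    using infsetsum_pmf_eq_1[OF assms] infsetsum_infsum[OF pmf_abs_summable[of p S]] by simp
  ultimately show ?thesis
    by (metis has_sum_infsum)
qed

lemma imrjmc_stationary_distribution:
  assumes \<alpha>: "\<And>s. 0 < \<alpha> s \<and> \<alpha> s < 1"
    and x: "set_pmf x \<subseteq> {0..size M}" "0 < pmf x (size M)" and M: "M \<noteq> {#}"
  shows "imrjmc_weight x \<alpha> summable_on imrjmc_states M \<and>
    (\<exists>p. stationary_distribution (imrjmc_states M) (imrjmc_step x \<alpha>) p \<and>
         (\<forall>q. stationary_distribution (imrjmc_states M) (imrjmc_step x \<alpha>) q \<longrightarrow> q = p) \<and>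
         (\<forall>s\<in>imrjmc_states M.
            pmf p s = 1 / partition_function M x \<alpha> * imrjmc_weight x \<alpha> s))"
proof -
  define p where "p = pair_pmf (multiperm_pmf \<alpha> M) (positions_pmf x 0 1 (size M))"
  define C where "C = (\<Sum>\<sigma>\<in>permutations_of_multiset M. code_weight \<alpha> \<sigma>) /
    (\<Prod>i<size M. tail x (Suc i))"
  have pos: "0 < \<alpha> s" for s
    using \<alpha> by blast
  have "0 < C"
    unfolding C_def
    by (intro divide_pos_pos sum_code_weight_pos prod_pos) (auto simp: pos intro: tail_pos[OF x(2)])
  have weight: "imrjmc_weight x \<alpha> s = C * pmf p s" if "s \<in> imrjmc_states M" for s
    unfolding C_def p_def using imrjmc_weight_eq_pmf[of \<alpha> x M s] pos x(2) that by simp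
  have sub: "set_pmf p \<subseteq> imrjmc_states M"
    unfolding p_def by (rule set_pmf_subset_imrjmc_states) (rule pos)
  \<comment> \<open>The weight is \<open>C\<close> times a probability mass function supported on
    the states. This gives summability and identifies the partition function as
    \<open>C\<close>.\<close>
  have "((\<lambda>s. C * pmf p s) has_sum C * 1) (imrjmc_states M)"
    by (intro has_sum_cmult_right has_sum_pmf sub)
  then have sum: "(imrjmc_weight x \<alpha> has_sum C) (imrjmc_states M)"
    using has_sum_cong[of "imrjmc_states M" "imrjmc_weight x \<alpha>", OF weight] by simp
  then have Z: "partition_function M x \<alpha> = C"
    unfolding partition_function_def by (rule infsumI)
  have p: "bind_pmf p (imrjmc_step x \<alpha>) = p"
    unfolding p_def by (rule imrjmc_stationary) (use assms in auto)
  have "q = p" if "stationary_distribution (imrjmc_states M) (imrjmc_step x \<alpha>) q" for q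
  proof (rule stationary_unique[OF _ p])
    show "bind_pmf q (imrjmc_step x \<alpha>) = q"
      using that by (simp add: stationary_distribution_def)
    fix s assume "s \<in> set_pmf q \<union> set_pmf p"
    then have "s \<in> imrjmc_states M"
      using that sub by (auto simp: stationary_distribution_def)
    then show "(s, (sorted_list_of_multiset M, [1..<Suc (size M)])) \<in>
        {(s, t). t \<in> set_pmf (imrjmc_step x \<alpha> s)}\<^sup>*"
      using assms by (intro imrjmc_reaches_sorted) auto
  qed
  moreover have "pmf p s = 1 / partition_function M x \<alpha> * imrjmc_weight x \<alpha> s"
    if "s \<in> imrjmc_states M" for s
    using \<open>0 < C\<close> that by (simp add: Z weight)
  moreover have "stationary_distribution (imrjmc_states M) (imrjmc_step x \<alpha>) p"
    using sub p by (simp add: stationary_distribution_def)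
  ultimately show ?thesis
    using has_sum_imp_summable[OF sum] by blast
qed

theorem theorem5p2:
  fixes M :: "nat multiset" and T b :: nat and x :: "nat pmf" and \<alpha> :: "nat \<Rightarrow> real"
  assumes "1 \<le> T" and "set_mset M = {1..T}" and "b = size M"
    and "set_pmf x \<subseteq> {0..b}" and "pmf x b > 0"
    and "\<And>i. 1 \<le> i \<Longrightarrow> i \<le> b - count M T \<Longrightarrow> 0 < \<alpha> i \<and> \<alpha> i < 1"
  shows "imrjmc_weight x \<alpha> summable_on imrjmc_states M \<and>
    (\<exists>p. stationary_distribution (imrjmc_states M) (imrjmc_step x \<alpha>) p \<and>
         (\<forall>q. stationary_distribution (imrjmc_states M) (imrjmc_step x \<alpha>) q \<longrightarrow> q = p) \<and>
         (\<forall>(\<tau>, ns)\<in>imrjmc_states M.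
            pmf p (\<tau>, ns) = 1 / partition_function M x \<alpha> * imrjmc_weight x \<alpha> (\<tau>, ns)))"
proof -
  define N where "N = b - count M T"
  \<comment> \<open>The preceding results assume all parameters to lie strictly between 0 and 1.
    Outside 1, ..., \<open>N\<close> an arbitrary such value is filled in, and neither the steps nor
    the weights on the state space see the difference.\<close>
  define \<beta> where "\<beta> s = (if 1 \<le> s \<and> s \<le> N then \<alpha> s else 1 / 2)" for s
  have \<beta>: "0 < \<beta> s \<and> \<beta> s < 1" for s
    using assms(6)[of s] by (simp add: \<beta>_def N_def)
  have eq: "\<alpha> s = \<beta> s" if "1 \<le> s" "s \<le> N" for s
    using that by (simp add: \<beta>_def)
  have le: "num_less \<tau> a \<le> N" if "\<tau> \<in> permutations_of_multiset M" "a \<in> set \<tau>" for \<tau> a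
  proof -
    have "mset \<tau> = M" using that(1) by (rule permutations_of_multisetD)
    moreover from this have "set \<tau> \<subseteq> {..T}" using assms(2) by (auto simp flip: set_mset_mset)
    ultimately show ?thesis
      using num_less_le[OF that(2), of T] assms(3) by (auto simp: N_def)
  qed
  have weight: "imrjmc_weight x \<alpha> s = imrjmc_weight x \<beta> s" if "s \<in> imrjmc_states M" for s
    using that code_weight_cong[of N \<alpha> \<beta>, OF eq le]
    by (auto simp: imrjmc_weight_def imrjmc_states_def)
  have step: "imrjmc_step x \<alpha> s = imrjmc_step x \<beta> s" if "s \<in> imrjmc_states M" for s
  proof -
    obtain \<tau> ns where s: "s = (\<tau>, ns)" by (cases s)
    have \<tau>: "\<tau> \<in> permutations_of_multiset M"
      using that by (auto simp: s imrjmc_states_def)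
    then have "length \<tau> = b"
      using assms(3) by (metis permutations_of_multisetD size_mset)
    then show ?thesis
      unfolding s using imrjmc_step_cong[of N \<alpha> \<beta> \<tau> x ns, OF eq le[OF \<tau>]] assms(4) by simp
  qed
  have Z: "partition_function M x \<alpha> = partition_function M x \<beta>"
    unfolding partition_function_def by (rule infsum_cong) (rule weight)
  have summable: "imrjmc_weight x \<alpha> summable_on imrjmc_states M \<longleftrightarrow>
      imrjmc_weight x \<beta> summable_on imrjmc_states M"
    by (rule summable_on_cong) (rule weight)
  have stat: "stationary_distribution (imrjmc_states M) (imrjmc_step x \<alpha>) p \<longleftrightarrow>
      stationary_distribution (imrjmc_states M) (imrjmc_step x \<beta>) p" for p
    by (rule stationary_distribution_cong) (rule step)
  have "M \<noteq> {#}"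
    using assms(1,2) by fastforce
  then have core: "imrjmc_weight x \<beta> summable_on imrjmc_states M \<and>
    (\<exists>p. stationary_distribution (imrjmc_states M) (imrjmc_step x \<beta>) p \<and>
         (\<forall>q. stationary_distribution (imrjmc_states M) (imrjmc_step x \<beta>) q \<longrightarrow> q = p) \<and>
         (\<forall>s\<in>imrjmc_states M.
            pmf p s = 1 / partition_function M x \<beta> * imrjmc_weight x \<beta> s))"
    by (intro imrjmc_stationary_distribution \<beta>) (use assms(3-5) in simp_all)
  then obtain p where p: "stationary_distribution (imrjmc_states M) (imrjmc_step x \<beta>) p"
      "\<forall>q. stationary_distribution (imrjmc_states M) (imrjmc_step x \<beta>) q \<longrightarrow> q = p"
      "\<forall>s\<in>imrjmc_states M. pmf p s = 1 / partition_function M x \<beta> * imrjmc_weight x \<beta> s"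
    by blast
  show ?thesis
    unfolding Z summable stat
  proof (intro conjI exI[of _ p] p(1,2))
    show "\<forall>(\<tau>, ns)\<in>imrjmc_states M.
        pmf p (\<tau>, ns) = 1 / partition_function M x \<beta> * imrjmc_weight x \<alpha> (\<tau>, ns)"
      using p(3) by (auto simp: weight)
  qed (use core in blast)
qed

end
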